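(* Let $0\le r<s$ be arbitrary. Then the functions $\varphi^s_r:\tilde\Omega^s_r\to\Lambda^s_r$ and $\varphi_r:\tilde\Omega_r\to\Lambda_r$ are continuous and onto.
   Context: Fix a constant $c>0$. For $0\le r<s$ and $a,b\in\mathbb{R}$ let $F_{r,a}=\{(t,x)\in\mathbb{R}^2: r\le t,\ a-c(t-r)\le x\le a+c(t-r)\}$, $B_{s,b}=\{(t,x)\in\mathbb{R}^2: t\le s,\ b-c(s-t)\le x\le b+c(s-t)\}$, and $P^{s,b}_{r,a}=F_{r,a}\cap B_{s,b}$ (nonempty if and only if $|b-a|\le c(s-r)$). When $P^{s,b}_{r,a}\ne\emptyset$ let $I^{s,b}_{r,a}=\{x\in\mathbb{R}:(\tfrac12(r+s),x)\in P^{s,b}_{r,a}\}$, a (possibly degenerate) closed interval. Also let $I^s_{r,a}=[a-c(s-r),a+c(s-r)]$. Standing assumptions: (i) for all such $r,s,a,b$ with $P^{s,b}_{r,a}\neq\emptyset$ we are given a continuous function $\lambda^{s,b}_{r,a}:[0,1]\to I^{s,b}_{r,a}$ mapping $[0,1]$ onto $I^{s,b}_{r,a}$, such that $(a,b,r,s,\xi)\mapsto\lambda^{s,b}_{r,a}(\xi)$ is continuous on $\{(a,b,r,s,\xi)\in\mathbb{R}^5: 0\le r<s,\ |b-a|\le c(s-r),\ \xi\in[0,1]\}$; (ii) for all $0\le r<s$ and $a\in\mathbb{R}$ we are given a continuous function $\lambda^s_{r,a}:[0,1]\to I^s_{r,a}$ onto $I^s_{r,a}$, such that $(a,r,s,\xi)\mapsto\lambda^s_{r,a}(\xi)$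 is continuous on $\{(a,r,s,\xi):a\in\mathbb{R},\ 0\le r<s,\ \xi\in[0,1]\}$; (iii) for each $r\ge 0$ we are given a function $\lambda_r:\mathbb{R}\to\mathbb{R}$ that is continuous and onto. For $0\le r<s$ let $t_{nj}=r+\frac{j}{2^n}(s-r)$ for $0\le j\le 2^n$, $n\ge 0$; $V^s_{r,n}=\{t_{nj}:0<j<2^n\}$ for $n\ge1$; $V^s_r=\bigcup_{n\ge1}V^s_{r,n}$; $\Omega^s_r=[0,1]^{V^s_r}$; $\hat V^s_r=V^s_r\cup\{s\}$, $\hat\Omega^s_r=[0,1]^{\hat V^s_r}$, with product topologies. The map $\hat\pi:\hat\Omega^s_r\to\Omega^s_r$ is restriction of coordinates to $V^s_r$. Let $\Lambda^s_r$ be the set of continuous $x:[r,s]\to\mathbb{R}$ with $|x(v)-x(u)|\le c|v-u|$ for all $u,v\in[r,s]$, with the uniform (sup-norm) topology; $\Lambda^{s,b}_{r,a}=\{x\in\Lambda^s_r: x(r)=a,\ x(s)=b\}$, $\Lambda^s_{r,a}=\{x\in\Lambda^s_r:x(r)=a\}$. Let $C_r$ be the set of continuous functions $x:[r,+\infty)\to\mathbb{R}$ with the compact-open topology, $\Lambda_r=\{x\in C_r:|x(v)-x(u)|\le c|v-u|\text{ for all }u,v\in[r,+\infty)\}$ with the subspace topology, $\Lambda_{r,a}=\{x\in\Lambda_r:x(r)=a\}$. Definition of $\varphi^{s,b}_{r,a}:\Omega^s_r\to\Lambda^{s,b}_{r,a}$ (when $P^{s,b}_{r,a}\neq\emptyset$):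 for $\omega\in\Omega^s_r$, the function $\varphi(\omega)=\varphi^{s,b}_{r,a}(\omega)$ is defined on $V^s_r\cup\{r,s\}$ recursively by $\varphi(\omega)(r)=a$, $\varphi(\omega)(s)=b$, and, for $m\ge1$ and $1\le j\le 2^{m-1}$, writing $a_{m-1,i}=\varphi(\omega)(t_{m-1,i})$, $$\varphi(\omega)(t_{m,2j-1})=\lambda^{t_{m-1,j},a_{m-1,j}}_{t_{m-1,j-1},a_{m-1,j-1}}(\omega_{t_{m,2j-1}})$$ (at each step the relevant set $P^{t_{m-1,j},a_{m-1,j}}_{t_{m-1,j-1},a_{m-1,j-1}}$ is nonempty, and $t_{m,2j}=t_{m-1,j}$). The resulting function is $c$-Lipschitz on the dense set $V^s_r\cup\{r,s\}$ and $\varphi^{s,b}_{r,a}(\omega)\in\Lambda^{s,b}_{r,a}$ denotes its unique continuous extension to $[r,s]$. Definition of $\varphi^s_{r,a}:\hat\Omega^s_r\to\Lambda^s_{r,a}$: $\varphi^s_{r,a}(\hat\omega)=\varphi^{s,b}_{r,a}(\hat\pi(\hat\omega))$ with $b=\lambda^s_{r,a}(\hat\omega_s)$. Definition of $\varphi_{r,a}$: let $r\ge0$ and let $m$ be the smallest integer with $m>r$. Let $\hat V_r=\hat V^m_r\cup\bigcup_{j=m}^\infty\hat V^{j+1}_j$ and $\hat\Omega_r=[0,1]^{\hat V_r}$ with the product topology. For $\hat\omega\in\hat\Omega_r$ let $\hat\pi_{r,m}(\hat\omega)\in\hat\Omega^m_r$ and $\hat\pi_{j,j+1}(\hat\omega)\in\hat\Omega^{j+1}_j$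 ($j\ge m$) be the restrictions of $\hat\omega$ to $\hat V^m_r$ and $\hat V^{j+1}_j$. For $a\in\mathbb{R}$, $\varphi_{r,a}(\hat\omega)\in\Lambda_{r,a}$ is the function given on $[r,m]$ by $\varphi^m_{r,a}(\hat\pi_{r,m}(\hat\omega))$ and, inductively for $j\ge m$, on $[j,j+1]$ by $\varphi^{j+1}_{j,d}(\hat\pi_{j,j+1}(\hat\omega))$ with $d=\varphi_{r,a}(\hat\omega)(j)$. Definition of $\varphi^s_r$ and $\varphi_r$: $\tilde\Omega^s_r=\mathbb{R}\times\hat\Omega^s_r$, $\tilde\Omega_r=\mathbb{R}\times\hat\Omega_r$ (product topologies); $\varphi^s_r(a,\hat\omega)=\varphi^s_{r,\lambda_r(a)}(\hat\omega)$ for $(a,\hat\omega)\in\tilde\Omega^s_r$, and $\varphi_r(a,\hat\omega)=\varphi_{r,\lambda_r(a)}(\hat\omega)$ for $(a,\hat\omega)\in\tilde\Omega_r$. *)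

theory Defs
  imports "HOL-Analysis.Analysis"
begin

text \<open>
  Points of the plane are pairs \<open>(t, x)\<close> of time and position. An index pair written below and
  above a symbol in the mathematics, as in $P^{s,b}_{r,a}$, becomes the argument list \<open>r a s b\<close>:
  start time, start position, end time, end position.
\<close>

definition forward_cone :: "real \<Rightarrow> real \<Rightarrow> real \<Rightarrow> (real \<times> real) set" where
  "forward_cone c r a = {(t, x). r \<le> t \<and> a - c * (t - r) \<le> x \<and> x \<le> a + c * (t - r)}"

definition backward_cone :: "real \<Rightarrow> real \<Rightarrow> real \<Rightarrow> (real \<times> real) set" where
  "backward_cone c s b = {(t, x). t \<le> s \<and> b - c * (s - t) \<le> x \<and> x \<le> b + c * (s - t)}"

definition parallelogram :: "real \<Rightarrow> real \<Rightarrow> real \<Rightarrow> real \<Rightarrow> real \<Rightarrow> (real \<times> real) set" where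
  "parallelogram c r a s b = forward_cone c r a \<inter> backward_cone c s b"

definition mid_interval :: "real \<Rightarrow> real \<Rightarrow> real \<Rightarrow> real \<Rightarrow> real \<Rightarrow> real set" where
  "mid_interval c r a s b = {x. ((r + s) / 2, x) \<in> parallelogram c r a s b}"

definition end_interval :: "real \<Rightarrow> real \<Rightarrow> real \<Rightarrow> real \<Rightarrow> real set" where
  "end_interval c r a s = {a - c * (s - r) .. a + c * (s - r)}"


definition dyadic :: "real \<Rightarrow> real \<Rightarrow> nat \<Rightarrow> nat \<Rightarrow> real" where
  "dyadic r s n j = r + real j / 2 ^ n * (s - r)"

definition V :: "real \<Rightarrow> real \<Rightarrow> real set" where
  "V r s = (\<Union>n\<in>{1..}. {dyadic r s n j | j. 0 < j \<and> j < 2 ^ n})"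

definition V_hat :: "real \<Rightarrow> real \<Rightarrow> real set" where
  "V_hat r s = V r s \<union> {s}"

text \<open>Since \<open>r \<ge> 0\<close> in all uses, every integer above \<open>r\<close> is a natural number.\<close>

definition next_int :: "real \<Rightarrow> nat" where
  "next_int r = (LEAST m. r < real m)"

definition V_hat_ray :: "real \<Rightarrow> real set" where
  "V_hat_ray r =
     V_hat r (real (next_int r)) \<union> (\<Union>j\<in>{next_int r..}. V_hat (real j) (real (j + 1)))"

text \<open>
  The cube $[0,1]^T$ with the product topology. Its points are the functions on \<open>T\<close>, represented
  as usual by functions that take the value \<open>undefined\<close> off \<open>T\<close>.
\<close>

definition cube :: "real set \<Rightarrow> (real \<Rightarrow> real) topology" where
  "cube T = product_topology (\<lambda>_. top_of_set {0..1}) T"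

definition Omega_tilde :: "real \<Rightarrow> real \<Rightarrow> (real \<times> (real \<Rightarrow> real)) topology" where
  "Omega_tilde r s = prod_topology euclideanreal (cube (V_hat r s))"

definition Omega_tilde_ray :: "real \<Rightarrow> (real \<times> (real \<Rightarrow> real)) topology" where
  "Omega_tilde_ray r = prod_topology euclideanreal (cube (V_hat_ray r))"


text \<open>\<open>cfunspace\<close> carries the supremum metric.\<close>

definition Lambda :: "real \<Rightarrow> real \<Rightarrow> real \<Rightarrow> (real \<Rightarrow> real) topology" where
  "Lambda c r s =
     subtopology (mtopology_of (cfunspace (top_of_set {r..s}) euclidean_metric))
       {x. c-lipschitz_on {r..s} x}"

definition compact_open :: "'a topology \<Rightarrow> 'b topology \<Rightarrow> ('a \<Rightarrow> 'b) topology" where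
  "compact_open X Y = topology_generated_by
     {{f. continuous_map X Y f \<and> f \<in> extensional (topspace X) \<and> f ` K \<subseteq> U} | K U.
        compactin X K \<and> openin Y U}"

definition Lambda_ray :: "real \<Rightarrow> real \<Rightarrow> (real \<Rightarrow> real) topology" where
  "Lambda_ray c r =
     subtopology (compact_open (top_of_set {r..}) euclideanreal) {x. c-lipschitz_on {r..} x}"

lemma topspace_cube: "topspace (cube T) = T \<rightarrow>\<^sub>E {0..1}"
  by (simp add: cube_def)

lemma topspace_Lambda:
  "topspace (Lambda c r s) = {x. x \<in> extensional {r..s} \<and> c-lipschitz_on {r..s} x}"
proof -
  have "Met_TC.mbounded (x ` {r..s})" if "c-lipschitz_on {r..s} x" for x :: "real \<Rightarrow> real"
  proof -
    have "bounded (x ` {r..s})"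
      using that lipschitz_on_continuous_on compact_continuous_image compact_imp_bounded by blast
    then show ?thesis
      unfolding Met_TC.mbounded_alt bounded_two_points by simp
  qed
  then show ?thesis
    by (auto simp: Lambda_def lipschitz_on_continuous_on)
qed

lemma topspace_compact_open:
  "topspace (compact_open X Y) = {f. continuous_map X Y f \<and> f \<in> extensional (topspace X)}"
proof -
  have "{f. continuous_map X Y f \<and> f \<in> extensional (topspace X) \<and> f ` {} \<subseteq> {}}
    \<in> {{f. continuous_map X Y f \<and> f \<in> extensional (topspace X) \<and> f ` K \<subseteq> U} | K U.
        compactin X K \<and> openin Y U}"
    by blast
  then show ?thesis
    unfolding compact_open_def topology_generated_by_topspace by auto
qed

lemma topspace_Lambda_ray:
  "topspace (Lambda_ray c r) = {x. x \<in> extensional {r..} \<and> c-lipschitz_on {r..} x}"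
  by (auto simp: Lambda_ray_def topspace_compact_open lipschitz_on_continuous_on)


text \<open>
  \<open>grid lamM r a s b \<omega> m i\<close> is the value prescribed at \<open>dyadic r s m i\<close>, for \<open>i \<le> 2 ^ m\<close>. The
  points with even index \<open>i\<close> are already on level \<open>m - 1\<close>. For odd $i = 2j-1$ the neighbours on
  level \<open>m - 1\<close> have the indices $j - 1 =$ \<open>i div 2\<close> and $j =$ \<open>i div 2 + 1\<close>.
\<close>

fun grid :: "(real \<Rightarrow> real \<Rightarrow> real \<Rightarrow> real \<Rightarrow> real \<Rightarrow> real) \<Rightarrow>
    real \<Rightarrow> real \<Rightarrow> real \<Rightarrow> real \<Rightarrow> (real \<Rightarrow> real) \<Rightarrow> nat \<Rightarrow> nat \<Rightarrow> real" where
  "grid lamM r a s b \<omega> 0 i = (if i = 0 then a else b)"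
| "grid lamM r a s b \<omega> (Suc m) i =
     (if even i then grid lamM r a s b \<omega> m (i div 2)
      else lamM (dyadic r s m (i div 2)) (grid lamM r a s b \<omega> m (i div 2))
                (dyadic r s m (i div 2 + 1)) (grid lamM r a s b \<omega> m (i div 2 + 1))
                (\<omega> (dyadic r s (Suc m) i)))"

text \<open>
  The maps $\varphi^{s,b}_{r,a}$, $\varphi^s_{r,a}$, $\varphi_{r,a}$, $\varphi^s_r$ and $\varphi_r$
  are \<open>phi_bridge\<close>, \<open>phi_from\<close>, \<open>phi_ray_from\<close>, \<open>phi\<close> and \<open>phi_ray\<close>. Their parameters
  \<open>lamM r a s b\<close>, \<open>lamE r a s\<close> and \<open>lamS r\<close> are the maps $\lambda^{s,b}_{r,a}$ (midpoint),
  $\lambda^s_{r,a}$ (endpoint) and $\lambda_r$ (starting point). The path in \<open>phi_bridge\<close> is the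
  continuous extension of the grid values, which is unique because the dyadic points are dense in
  \<open>{r..s}\<close>; the path in \<open>phi_ray_from\<close> is unique because its pieces determine it successively.
\<close>

definition phi_bridge :: "(real \<Rightarrow> real \<Rightarrow> real \<Rightarrow> real \<Rightarrow> real \<Rightarrow> real) \<Rightarrow>
    real \<Rightarrow> real \<Rightarrow> real \<Rightarrow> real \<Rightarrow> (real \<Rightarrow> real) \<Rightarrow> (real \<Rightarrow> real)" where
  "phi_bridge lamM r a s b \<omega> =
     (THE x. x \<in> extensional {r..s} \<and> continuous_on {r..s} x \<and>
        (\<forall>m. \<forall>i \<le> 2 ^ m. x (dyadic r s m i) = grid lamM r a s b \<omega> m i))"

definition phi_from :: "(real \<Rightarrow> real \<Rightarrow> real \<Rightarrow> real \<Rightarrow> real \<Rightarrow> real) \<Rightarrow>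
    (real \<Rightarrow> real \<Rightarrow> real \<Rightarrow> real \<Rightarrow> real) \<Rightarrow>
    real \<Rightarrow> real \<Rightarrow> real \<Rightarrow> (real \<Rightarrow> real) \<Rightarrow> (real \<Rightarrow> real)" where
  "phi_from lamM lamE r a s \<omega> =
     phi_bridge lamM r a s (lamE r a s (\<omega> s)) (restrict \<omega> (V r s))"

definition phi_ray_from :: "(real \<Rightarrow> real \<Rightarrow> real \<Rightarrow> real \<Rightarrow> real \<Rightarrow> real) \<Rightarrow>
    (real \<Rightarrow> real \<Rightarrow> real \<Rightarrow> real \<Rightarrow> real) \<Rightarrow>
    real \<Rightarrow> real \<Rightarrow> (real \<Rightarrow> real) \<Rightarrow> (real \<Rightarrow> real)" where
  "phi_ray_from lamM lamE r a \<omega> = (let m = next_int r in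
     (THE x. x \<in> extensional {r..} \<and>
        (\<forall>t\<in>{r..real m}. x t = phi_from lamM lamE r a (real m) (restrict \<omega> (V_hat r (real m))) t) \<and>
        (\<forall>j\<ge>m. \<forall>t\<in>{real j..real (j + 1)}.
           x t = phi_from lamM lamE (real j) (x (real j)) (real (j + 1))
                   (restrict \<omega> (V_hat (real j) (real (j + 1)))) t)))"

definition phi :: "(real \<Rightarrow> real \<Rightarrow> real \<Rightarrow> real \<Rightarrow> real \<Rightarrow> real) \<Rightarrow>
    (real \<Rightarrow> real \<Rightarrow> real \<Rightarrow> real \<Rightarrow> real) \<Rightarrow> (real \<Rightarrow> real \<Rightarrow> real) \<Rightarrow>
    real \<Rightarrow> real \<Rightarrow> real \<times> (real \<Rightarrow> real) \<Rightarrow> (real \<Rightarrow> real)" where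
  "phi lamM lamE lamS r s = (\<lambda>(a, \<omega>). phi_from lamM lamE r (lamS r a) s \<omega>)"

definition phi_ray :: "(real \<Rightarrow> real \<Rightarrow> real \<Rightarrow> real \<Rightarrow> real \<Rightarrow> real) \<Rightarrow>
    (real \<Rightarrow> real \<Rightarrow> real \<Rightarrow> real \<Rightarrow> real) \<Rightarrow> (real \<Rightarrow> real \<Rightarrow> real) \<Rightarrow>
    real \<Rightarrow> real \<times> (real \<Rightarrow> real) \<Rightarrow> (real \<Rightarrow> real)" where
  "phi_ray lamM lamE lamS r = (\<lambda>(a, \<omega>). phi_ray_from lamM lamE r (lamS r a) \<omega>)"

end

theory Submission
  imports Defs
begin

text \<open>
  \<^emph>\<open>Bridges.\<close> If $|b-a| \le c(s-r)$, every value that the midpoint map can prescribe at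
  $(r+s)/2$ differs from both \<open>a\<close> and \<open>b\<close> by at most $c(s-r)/2$. So the two halves are again
  admissible problems of the same kind, and by induction all grid values are \<open>c\<close>-Lipschitz on the
  dyadic points (\<open>grid_lipschitz\<close>). Hence they extend to a \<open>c\<close>-Lipschitz path on \<open>{r..s}\<close>, uniquely
  because the dyadic points are dense (\<open>phi_bridge_extends_grid\<close>, \<open>phi_bridge_eqI\<close>). Conversely a
  \<open>c\<close>-Lipschitz path takes at each midpoint a value that the midpoint map reaches, and each
  interior dyadic point is the midpoint of exactly one dyadic interval, so its coordinate of \<open>\<omega>\<close> can be chosen to
  produce that value (\<open>grid_onto\<close>).

  \<^emph>\<open>Continuity.\<close> Each single grid value is a finite composition of the given continuous maps and
  coordinates of \<open>\<omega>\<close> (\<open>continuous_map_grid\<close>). All paths have the same Lipschitz constant, so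
  control at the points of a finite net gives control on a whole compact set
  (\<open>lipschitz_family_locally_uniform\<close>); continuity at a dense set of times is therefore continuity
  for the supremum metric on \<open>{r..s}\<close> and for the compact-open topology on \<open>{r..}\<close>. To treat the
  starting point, the end point and \<open>\<omega>\<close> jointly, the continuity lemmas let these data depend
  continuously on a point of an arbitrary topological space \<open>X\<close>.

  \<^emph>\<open>Half-lines.\<close> The path is built from countably many bounded pieces between consecutive
  breakpoints. The coordinates used by different pieces are disjoint
  (\<open>V_hat_breakpoint_disjoint\<close>), which makes surjectivity a matter of combining choices made piece
  by piece. For continuity, the value at a breakpoint is the starting point of the next piece, so
  that continuity at each time follows by induction on the breakpoints.
\<close>

section \<open>Dyadic points\<close>

lemma dyadic_0 [simp]: "dyadic r s n 0 = r"
  by (simp add: dyadic_def)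

lemma dyadic_last [simp]: "dyadic r s n (2 ^ n) = s"
  by (simp add: dyadic_def)

lemma dyadic_diff: "dyadic r s n j - dyadic r s n i = (real j - real i) * ((s - r) / 2 ^ n)"
  by (simp add: dyadic_def field_simps)

lemma dyadic_refine: "dyadic r s (n + k) (2 ^ k * i) = dyadic r s n i"
  by (simp add: dyadic_def power_add field_simps)

lemma dyadic_double: "dyadic r s (Suc n) (2 * i) = dyadic r s n i"
  using dyadic_refine[of r s n 1 i] by simp

lemma dyadic_mid: "dyadic r s (Suc n) (2 * i + 1) = (dyadic r s n i + dyadic r s n (i + 1)) / 2"
  by (simp add: dyadic_def field_simps)

lemma dyadic_strict_mono:
  assumes "r < s" "i < j"
  shows "dyadic r s n i < dyadic r s n j"
proof -
  have "0 < (real j - real i) * ((s - r) / 2 ^ n)"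
    using assms by simp
  then show ?thesis
    using dyadic_diff[of r s n j i] by linarith
qed

lemma dyadic_eq_iff:
  assumes "r < s"
  shows "dyadic r s m i = dyadic r s n j \<longleftrightarrow> 2 ^ n * i = 2 ^ m * j"
proof -
  have "dyadic r s m i = dyadic r s n j \<longleftrightarrow> real i / 2 ^ m = real j / 2 ^ n"
    using assms by (simp add: dyadic_def del: times_divide_eq_left)
  also have "\<dots> \<longleftrightarrow> real (2 ^ n * i) = real (2 ^ m * j)"
    by (simp add: field_simps)
  finally show ?thesis
    by (simp only: of_nat_eq_iff)
qed

text \<open>
  Every dyadic point other than the two ends of the interval is introduced at exactly one level, so
  that one coordinate of \<open>\<omega>\<close> never has to serve two subdivision steps.
\<close>

lemma dyadic_odd_unique:
  assumes "r < s" "odd i" "odd j" "dyadic r s (Suc m) i = dyadic r s (Suc n) j"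
  shows "m = n \<and> i = j"
proof -
  have eq: "2 ^ n * i = 2 ^ m * j"
    using assms by (simp add: dyadic_eq_iff)
  \<comment> \<open>The exponents are the multiplicity of the prime \<open>2\<close> on the two sides.\<close>
  have "multiplicity 2 (2 ^ n * i) = n" "multiplicity 2 (2 ^ m * j) = m"
    using assms by (auto intro!: multiplicity_eqI simp: mult.commute)
  then show ?thesis
    using eq by simp
qed

lemma dyadic_ge: "r \<le> s \<Longrightarrow> r \<le> dyadic r s n i"
  by (simp add: dyadic_def)

lemma dyadic_le:
  assumes "r \<le> s" "i \<le> 2 ^ n"
  shows "dyadic r s n i \<le> s"
proof -
  have "real i / 2 ^ n \<le> 1"
    using assms by (simp add: divide_le_eq_1)
  then have "real i / 2 ^ n * (s - r) \<le> 1 * (s - r)"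
    using assms by (intro mult_right_mono) auto
  then show ?thesis
    by (simp add: dyadic_def)
qed

lemma dyadic_odd_in_V: "odd i \<Longrightarrow> i < 2 ^ Suc m \<Longrightarrow> dyadic r s (Suc m) i \<in> V r s"
  unfolding V_def by (rule UN_I[of "Suc m"]) (auto intro!: exI[of _ i] elim: oddE)

lemma V_subset_Ioo:
  assumes "r < s"
  shows "V r s \<subseteq> {r<..<s}"
proof
  fix t assume "t \<in> V r s"
  then obtain n j where "t = dyadic r s n j" "0 < j" "j < 2 ^ n"
    by (auto simp: V_def)
  then show "t \<in> {r<..<s}"
    using dyadic_strict_mono[OF assms, of 0 j n] dyadic_strict_mono[OF assms, of j "2 ^ n" n] by simp
qed

definition dyadics_of :: "real \<Rightarrow> real \<Rightarrow> real set" where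
  "dyadics_of r s = {dyadic r s m i | m i. i \<le> 2 ^ m}"

lemma closure_dyadics_of:
  assumes "r < s"
  shows "closure (dyadics_of r s) = {r..s}"
proof
  have "dyadics_of r s \<subseteq> {r..s}"
    using assms by (auto simp: dyadics_of_def dyadic_ge dyadic_le)
  then show "closure (dyadics_of r s) \<subseteq> {r..s}"
    by (simp add: closure_minimal)
  show "{r..s} \<subseteq> closure (dyadics_of r s)"
  proof
    fix t assume t: "t \<in> {r..s}"
    show "t \<in> closure (dyadics_of r s)"
      unfolding closure_approachable
    proof (intro allI impI)
      fix e :: real assume "0 < e"
      then obtain n where n: "(1 / 2) ^ n < e / (s - r)"
        using assms real_arch_pow_inv[of "e / (s - r)" "1 / 2"] by auto
      define u where "u = (t - r) / (s - r) * 2 ^ n"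
      define i where "i = nat \<lfloor>u\<rfloor>"
      have "0 \<le> (t - r) / (s - r)" "(t - r) / (s - r) \<le> 1"
        using t assms by auto
      from mult_right_mono[OF this(2), of "2 ^ n"] mult_nonneg_nonneg[OF this(1), of "2 ^ n"]
      have u: "0 \<le> u" "u \<le> 2 ^ n"
        by (simp_all add: u_def)
      then have i: "real i \<le> u" "u < real i + 1"
        by (auto simp: i_def)
      have "real i \<le> 2 ^ n"
        using i u by linarith
      then have "i \<le> 2 ^ n"
        by simp
      moreover have "dist (dyadic r s n i) t < e"
      proof -
        have "t = r + u / 2 ^ n * (s - r)"
          using assms by (simp add: u_def)
        then have "t - dyadic r s n i = (u - i) / 2 ^ n * (s - r)"
          by (simp add: dyadic_def field_simps)
        moreover have "0 \<le> (u - i) / 2 ^ n * (s - r)"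
          using i assms by simp
        moreover have "(u - i) / 2 ^ n * (s - r) \<le> 1 / 2 ^ n * (s - r)"
          using i assms by (intro mult_right_mono divide_right_mono) auto
        moreover have "1 / 2 ^ n * (s - r) < e"
          using n assms by (simp add: field_simps)
        ultimately show ?thesis
          by (simp add: dist_real_def)
      qed
      ultimately show "\<exists>y\<in>dyadics_of r s. dist y t < e"
        by (auto simp: dyadics_of_def)
    qed
  qed
qed


section \<open>Families of Lipschitz functions\<close>

text \<open>
  Equicontinuity in its simplest form: a compact \<open>K\<close> is covered by finitely many balls of radius
  \<open>e / (3 * L)\<close> centred in \<open>D\<close>. Pointwise closeness up to \<open>e / 3\<close> at the centres is an open
  condition on \<open>x\<close>, and passing from a point of \<open>K\<close> to a centre costs \<open>e / 3\<close> for each of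
  \<open>\<Phi> x\<close> and \<open>\<Phi> x0\<close>.
\<close>

lemma lipschitz_family_locally_uniform:
  fixes \<Phi> :: "'a \<Rightarrow> real \<Rightarrow> real"
  assumes L: "L > 0"
    and K: "compact K" "K \<subseteq> T" "K \<subseteq> closure D" "D \<subseteq> T"
    and lip: "\<And>x. x \<in> topspace X \<Longrightarrow> L-lipschitz_on T (\<Phi> x)"
    and cont: "\<And>t. t \<in> D \<Longrightarrow> continuous_map X euclideanreal (\<lambda>x. \<Phi> x t)"
    and x0: "x0 \<in> topspace X" and e: "e > 0"
  obtains U where "openin X U" "x0 \<in> U" "\<And>x t. x \<in> U \<Longrightarrow> t \<in> K \<Longrightarrow> \<bar>\<Phi> x t - \<Phi> x0 t\<bar> < e"
proof -
  define \<delta> where "\<delta> = e / (3 * L)"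
  have \<delta>: "\<delta> > 0" "L * \<delta> = e / 3"
    using L e by (auto simp: \<delta>_def)
  have "K \<subseteq> (\<Union>d\<in>D. ball d \<delta>)"
  proof
    fix t assume "t \<in> K"
    then obtain d where "d \<in> D" "dist d t < \<delta>"
      using K(3) \<delta>(1) unfolding closure_approachable subset_iff by blast
    then show "t \<in> (\<Union>d\<in>D. ball d \<delta>)"
      by auto
  qed
  then obtain F where F: "F \<subseteq> D" "finite F" "K \<subseteq> (\<Union>d\<in>F. ball d \<delta>)"
    using compactE_image[OF K(1), of D "\<lambda>d. ball d \<delta>"] by (metis (no_types, lifting) open_ball)
  define U where "U = {x \<in> topspace X. \<forall>d\<in>F. \<Phi> x d \<in> ball (\<Phi> x0 d) (e / 3)}"
  have "U = topspace X \<inter> (\<Inter>d\<in>F. {x \<in> topspace X. \<Phi> x d \<in> ball (\<Phi> x0 d) (e / 3)})"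
    by (auto simp: U_def)
  moreover have "openin X \<dots>"
  proof (intro openin_Int_Inter openin_topspace)
    show "finite ((\<lambda>d. {x \<in> topspace X. \<Phi> x d \<in> ball (\<Phi> x0 d) (e / 3)}) ` F)"
      using F by simp
    fix S assume "S \<in> (\<lambda>d. {x \<in> topspace X. \<Phi> x d \<in> ball (\<Phi> x0 d) (e / 3)}) ` F"
    then obtain d where "d \<in> D" "S = {x \<in> topspace X. \<Phi> x d \<in> ball (\<Phi> x0 d) (e / 3)}"
      using F by blast
    then show "openin X S"
      using openin_continuous_map_preimage[OF cont, of d "ball (\<Phi> x0 d) (e / 3)"] by simp
  qed
  ultimately have "openin X U"
    by simp
  moreover have "x0 \<in> U"
    using x0 e by (simp add: U_def)
  moreover have "\<bar>\<Phi> x t - \<Phi> x0 t\<bar> < e" if x: "x \<in> U" and t: "t \<in> K" for x t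
  proof -
    obtain d where d: "d \<in> F" "dist t d < \<delta>"
      using F t by (auto simp: dist_commute)
    have "dist (\<Phi> y t) (\<Phi> y d) \<le> e / 3" if "y \<in> topspace X" for y
    proof -
      have "dist (\<Phi> y t) (\<Phi> y d) \<le> L * dist t d"
        using lipschitz_onD[OF lip[OF that]] t d F K by blast
      also have "\<dots> \<le> L * \<delta>"
        using d L by simp
      finally show ?thesis
        using \<delta> by simp
    qed
    then have "dist (\<Phi> x t) (\<Phi> x d) \<le> e / 3" "dist (\<Phi> x0 t) (\<Phi> x0 d) \<le> e / 3"
      using x x0 by (auto simp: U_def)
    moreover have "dist (\<Phi> x0 d) (\<Phi> x d) < e / 3"
      using x d by (simp add: U_def)
    ultimately show ?thesis
      unfolding dist_real_def by linarith
  qed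
  ultimately show ?thesis
    using that by blast
qed

lemma continuous_map_into_Lambda:
  assumes c: "c > 0" and D: "{r..s} \<subseteq> closure D" "D \<subseteq> {r..s}"
    and Phi: "\<And>x. x \<in> topspace X \<Longrightarrow> \<Phi> x \<in> topspace (Lambda c r s)"
    and cont: "\<And>t. t \<in> D \<Longrightarrow> continuous_map X euclideanreal (\<lambda>x. \<Phi> x t)"
  shows "continuous_map X (Lambda c r s) \<Phi>"
proof -
  let ?m = "cfunspace (top_of_set {r..s}) (euclidean_metric :: real metric)"
  have mspace: "\<Phi> x \<in> mspace ?m" if "x \<in> topspace X" for x
    using Phi[OF that] unfolding Lambda_def by simp
  have lip: "c-lipschitz_on {r..s} (\<Phi> x)" if "x \<in> topspace X" for x
    using Phi[OF that] by (simp add: topspace_Lambda)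
  interpret Metric_space "mspace ?m" "mdist ?m"
    by (rule Metric_space_mspace_mdist)
  have "continuous_map X mtopology \<Phi>"
    unfolding continuous_map_to_metric
  proof (intro ballI allI impI)
    fix x0 and e :: real
    assume x0: "x0 \<in> topspace X" and e: "0 < e"
    obtain U where U: "openin X U" "x0 \<in> U"
        "\<And>x t. x \<in> U \<Longrightarrow> t \<in> {r..s} \<Longrightarrow> \<bar>\<Phi> x t - \<Phi> x0 t\<bar> < e / 2"
      using lipschitz_family_locally_uniform[OF c compact_Icc order_refl D lip cont x0, of "e / 2"] e
      by auto
    have "\<Phi> x \<in> mball (\<Phi> x0) e" if "x \<in> U" for x
    proof -
      have "x \<in> topspace X"
        using U(1) that openin_subset by blast
      then have "\<Phi> x \<in> mspace ?m"
        by (rule mspace)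
      moreover have "mdist ?m (\<Phi> x0) (\<Phi> x) \<le> e / 2"
        using e U(3)[OF that]
        by (intro mdist_cfunspace_le) (auto simp: dist_real_def abs_minus_commute less_imp_le)
      ultimately show ?thesis
        unfolding in_mball using mspace[OF x0] e by linarith
    qed
    then show "\<exists>U. openin X U \<and> x0 \<in> U \<and> (\<forall>y\<in>U. \<Phi> y \<in> mball (\<Phi> x0) e)"
      using U by blast
  qed
  then show ?thesis
    using lip by (auto simp: Lambda_def continuous_map_in_subtopology mtopology_of_def)
qed

lemma continuous_map_eval_lipschitz:
  assumes c: "c > 0" and D: "T \<subseteq> closure D" "D \<subseteq> T" and t: "t \<in> T"
    and lip: "\<And>x. x \<in> topspace X \<Longrightarrow> c-lipschitz_on T (\<Phi> x)"
    and cont: "\<And>t. t \<in> D \<Longrightarrow> continuous_map X euclideanreal (\<lambda>x. \<Phi> x t)"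
  shows "continuous_map X euclideanreal (\<lambda>x. \<Phi> x (t :: real))"
proof -
  have "continuous_map X Met_TC.mtopology (\<lambda>x. \<Phi> x t)"
    unfolding Met_TC.continuous_map_to_metric
  proof (intro ballI allI impI)
    fix x0 and e :: real
    assume x0: "x0 \<in> topspace X" and e: "0 < e"
    obtain U where "openin X U" "x0 \<in> U"
        "\<And>x u. x \<in> U \<Longrightarrow> u \<in> {t} \<Longrightarrow> \<bar>\<Phi> x u - \<Phi> x0 u\<bar> < e"
      using lipschitz_family_locally_uniform[OF c _ _ _ D(2) lip cont x0 e, of "{t}"] t D
      by auto
    then show "\<exists>U. openin X U \<and> x0 \<in> U \<and> (\<forall>y\<in>U. \<Phi> y t \<in> Met_TC.mball (\<Phi> x0 t) e)"
      by (auto simp: dist_real_def abs_minus_commute)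
  qed
  then show ?thesis
    by simp
qed

lemma continuous_map_into_Lambda_ray:
  assumes c: "c > 0"
    and Phi: "\<And>x. x \<in> topspace X \<Longrightarrow> \<Phi> x \<in> topspace (Lambda_ray c r)"
    and cont: "\<And>t. r \<le> t \<Longrightarrow> continuous_map X euclideanreal (\<lambda>x. \<Phi> x t)"
  shows "continuous_map X (Lambda_ray c r) \<Phi>"
proof -
  have lip: "c-lipschitz_on {r..} (\<Phi> x)" if "x \<in> topspace X" for x
    using Phi[OF that] by (simp add: topspace_Lambda_ray)
  have "continuous_map X (compact_open (top_of_set {r..}) euclideanreal) \<Phi>"
    unfolding compact_open_def
  proof (rule continuous_on_generated_topo)
    show "\<Phi> ` topspace X \<subseteq> \<Union> {{f. continuous_map (top_of_set {r..}) euclideanreal f \<and>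
        f \<in> extensional (topspace (top_of_set {r..})) \<and> f ` K \<subseteq> U} | K U.
        compactin (top_of_set {r..}) K \<and> openin euclideanreal U}"
      using Phi topspace_compact_open[of "top_of_set {r..}" euclideanreal]
      unfolding compact_open_def topology_generated_by_topspace Lambda_ray_def by auto
    fix S assume "S \<in> {{f. continuous_map (top_of_set {r..}) euclideanreal f \<and>
        f \<in> extensional (topspace (top_of_set {r..})) \<and> f ` K \<subseteq> U} | K U.
        compactin (top_of_set {r..}) K \<and> openin euclideanreal U}"
    then obtain K U where S: "S = {f. continuous_on {r..} f \<and> f \<in> extensional {r..} \<and> f ` K \<subseteq> U}"
      and K: "compact K" "K \<subseteq> {r..}" and U: "open U"
      by (auto simp: compactin_subtopology)
    have cont_Phi: "continuous_on {r..} (\<Phi> x)" if "x \<in> topspace X" for x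
      using lip[OF that] by (rule lipschitz_on_continuous_on)
    have eq: "\<Phi> -` S \<inter> topspace X = {x \<in> topspace X. \<Phi> x ` K \<subseteq> U}"
      using Phi cont_Phi by (auto simp: S topspace_Lambda_ray)
    show "openin X (\<Phi> -` S \<inter> topspace X)"
      unfolding eq
    proof (subst openin_subopen, intro ballI)
      fix x0 assume x0: "x0 \<in> {x \<in> topspace X. \<Phi> x ` K \<subseteq> U}"
      then have "compact (\<Phi> x0 ` K)"
        using K cont_Phi by (intro compact_continuous_image) (auto intro: continuous_on_subset)
      then obtain e where e: "e > 0" "(\<Union>y\<in>\<Phi> x0 ` K. ball y e) \<subseteq> U"
        using compact_subset_open_imp_ball_epsilon_subset U x0 by blast
      obtain W where W: "openin X W" "x0 \<in> W"
          "\<And>x t. x \<in> W \<Longrightarrow> t \<in> K \<Longrightarrow> \<bar>\<Phi> x t - \<Phi> x0 t\<bar> < e"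
        using lipschitz_family_locally_uniform[OF c K _ order_refl lip cont _ e(1), of x0] K x0
        by auto
      have "\<Phi> x t \<in> U" if "x \<in> W" "t \<in> K" for x t
      proof -
        have "\<Phi> x t \<in> ball (\<Phi> x0 t) e"
          using W(3)[OF that] by (simp add: dist_real_def abs_minus_commute)
        then show ?thesis
          using e(2) that(2) by blast
      qed
      then have "W \<subseteq> {x \<in> topspace X. \<Phi> x ` K \<subseteq> U}"
        using W(1) openin_subset by blast
      with W show "\<exists>T. openin X T \<and> x0 \<in> T \<and> T \<subseteq> {x \<in> topspace X. \<Phi> x ` K \<subseteq> U}"
        by blast
    qed
  qed
  then show ?thesis
    using lip by (auto simp: Lambda_ray_def continuous_map_in_subtopology)
qed


section \<open>Bridges between two points\<close>

locale path_selection =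
  fixes c :: real
    and lamM :: "real \<Rightarrow> real \<Rightarrow> real \<Rightarrow> real \<Rightarrow> real \<Rightarrow> real"
    and lamE :: "real \<Rightarrow> real \<Rightarrow> real \<Rightarrow> real \<Rightarrow> real"
  assumes c_pos: "c > 0"
    and lamM_image: "\<And>r a s b. 0 \<le> r \<Longrightarrow> r < s \<Longrightarrow> parallelogram c r a s b \<noteq> {} \<Longrightarrow>
           lamM r a s b ` {0..1} = mid_interval c r a s b"
    and lamM_cont: "continuous_on
           {(a, b, r, s, \<xi>). 0 \<le> r \<and> r < s \<and> \<bar>b - a\<bar> \<le> c * (s - r) \<and> \<xi> \<in> {0..1}}
           (\<lambda>(a, b, r, s, \<xi>). lamM r a s b \<xi>)"
    and lamE_image: "\<And>r a s. 0 \<le> r \<Longrightarrow> r < s \<Longrightarrow> lamE r a s ` {0..1} = end_interval c r a s"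
    and lamE_cont: "continuous_on
           {(a, r, s, \<xi>). 0 \<le> r \<and> r < s \<and> \<xi> \<in> {0..1}}
           (\<lambda>(a, r, s, \<xi>). lamE r a s \<xi>)"
begin

lemma lamM_range:
  assumes "0 \<le> r" "r < s" "\<bar>b - a\<bar> \<le> c * (s - r)"
  shows "lamM r a s b ` {0..1} = {x. \<bar>x - a\<bar> \<le> c * ((s - r) / 2) \<and> \<bar>b - x\<bar> \<le> c * ((s - r) / 2)}"
proof -
  have "(r, a) \<in> parallelogram c r a s b"
    using assms by (auto simp: parallelogram_def forward_cone_def backward_cone_def abs_le_iff)
  then have "lamM r a s b ` {0..1} = mid_interval c r a s b"
    using assms by (intro lamM_image) auto
  moreover have "(r + s) / 2 - r = (s - r) / 2" "s - (r + s) / 2 = (s - r) / 2"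
    by (simp_all add: field_simps)
  ultimately show ?thesis
    using assms
    unfolding mid_interval_def parallelogram_def forward_cone_def backward_cone_def abs_le_iff
    by auto
qed

lemma lamE_range:
  assumes "0 \<le> r" "r < s"
  shows "lamE r a s ` {0..1} = {b. \<bar>b - a\<bar> \<le> c * (s - r)}"
  using lamE_image[OF assms] by (auto simp: end_interval_def abs_le_iff)

lemma continuous_map_lamM:
  assumes rs: "0 \<le> r" "r < s"
    and cont: "continuous_map X euclideanreal A" "continuous_map X euclideanreal B"
      "continuous_map X (top_of_set {0..1}) \<xi>"
    and adm: "\<And>x. x \<in> topspace X \<Longrightarrow> \<bar>B x - A x\<bar> \<le> c * (s - r)"
  shows "continuous_map X euclideanreal (\<lambda>x. lamM r (A x) s (B x) (\<xi> x))"
proof -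
  let ?S = "{(a, b, r, s, \<xi>). 0 \<le> r \<and> r < s \<and> \<bar>b - a\<bar> \<le> c * (s - r) \<and> \<xi> \<in> {0..1::real}}"
  have "continuous_map X euclideanreal \<xi>" and "\<xi> ` topspace X \<subseteq> {0..1}"
    using cont(3) by (auto simp: continuous_map_in_subtopology)
  with cont have "continuous_map X (prod_topology euclidean (prod_topology euclidean (prod_topology
      euclidean (prod_topology euclidean euclidean)))) (\<lambda>x. (A x, B x, r, s, \<xi> x))"
    by (intro continuous_map_pairedI) auto
  then have tuple: "continuous_map X (top_of_set ?S) (\<lambda>x. (A x, B x, r, s, \<xi> x))"
    using rs adm \<open>\<xi> ` topspace X \<subseteq> {0..1}\<close> by (auto simp: continuous_map_in_subtopology)
  have "continuous_map (top_of_set ?S) euclideanreal (\<lambda>(a, b, r, s, \<xi>). lamM r a s b \<xi>)"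
    using lamM_cont by simp
  from continuous_map_compose[OF tuple this] show ?thesis
    by (simp add: o_def)
qed

lemma continuous_map_lamE:
  assumes rs: "0 \<le> r" "r < s"
    and cont: "continuous_map X euclideanreal A" "continuous_map X (top_of_set {0..1}) \<xi>"
  shows "continuous_map X euclideanreal (\<lambda>x. lamE r (A x) s (\<xi> x))"
proof -
  let ?S = "{(a, r, s, \<xi>). 0 \<le> r \<and> r < s \<and> \<xi> \<in> {0..1::real}} :: (real \<times> real \<times> real \<times> real) set"
  have "continuous_map X euclideanreal \<xi>" and "\<xi> ` topspace X \<subseteq> {0..1}"
    using cont(2) by (auto simp: continuous_map_in_subtopology)
  with cont have "continuous_map X (prod_topology euclidean (prod_topology
      euclidean (prod_topology euclidean euclidean))) (\<lambda>x. (A x, r, s, \<xi> x))"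
    by (intro continuous_map_pairedI) auto
  then have tuple: "continuous_map X (top_of_set ?S) (\<lambda>x. (A x, r, s, \<xi> x))"
    using rs \<open>\<xi> ` topspace X \<subseteq> {0..1}\<close> by (auto simp: continuous_map_in_subtopology)
  have "continuous_map (top_of_set ?S) euclideanreal (\<lambda>(a, r, s, \<xi>). lamE r a s \<xi>)"
    using lamE_cont by simp
  from continuous_map_compose[OF tuple this] show ?thesis
    by (simp add: o_def)
qed

text \<open>
  Grid points of different levels can thus be compared at a common finer level.
\<close>

lemma grid_refine: "grid lamM r a s b \<omega> (m + k) (2 ^ k * i) = grid lamM r a s b \<omega> m i"
  by (induction k) (simp_all add: mult.assoc)

text \<open>
  This is the invariant that keeps the recursion inside the domain of the midpoint map: the slope
  bound on an interval of level \<open>m\<close> makes the next midpoint problem admissible, and the range of the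
  midpoint map gives the bound on its two halves.
\<close>

lemma grid_adjacent:
  assumes "0 \<le> r" "r < s" "\<bar>b - a\<bar> \<le> c * (s - r)" "\<And>t. t \<in> V r s \<Longrightarrow> \<omega> t \<in> {0..1}" "i < 2 ^ m"
  shows "\<bar>grid lamM r a s b \<omega> m (i + 1) - grid lamM r a s b \<omega> m i\<bar>
    \<le> c * (dyadic r s m (i + 1) - dyadic r s m i)"
  using assms(5)
proof (induction m arbitrary: i)
  case 0
  then show ?case
    using assms(3) by (simp add: dyadic_def)
next
  case (Suc m)
  let ?g = "grid lamM r a s b \<omega>" and ?t = "dyadic r s"
  define k where "k = i div 2"
  have k: "k < 2 ^ m"
    using Suc.prems by (simp add: k_def less_mult_imp_div_less mult.commute)
  have half: "(?t m (k + 1) - ?t m k) / 2 = ?t (Suc m) (i + 1) - ?t (Suc m) i"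
    by (simp add: dyadic_diff)
  have "?t (Suc m) (2 * k + 1) \<in> V r s"
    using k by (intro dyadic_odd_in_V) auto
  then have "\<omega> (?t (Suc m) (2 * k + 1)) \<in> {0..1}"
    by (rule assms(4))
  moreover have "0 \<le> ?t m k" "?t m k < ?t m (k + 1)"
    using assms dyadic_ge[of r s m k] dyadic_strict_mono[of r s k "k + 1" m] by auto
  ultimately have mid: "\<bar>?g (Suc m) (2 * k + 1) - ?g m k\<bar> \<le> c * ((?t m (k + 1) - ?t m k) / 2)"
      "\<bar>?g m (k + 1) - ?g (Suc m) (2 * k + 1)\<bar> \<le> c * ((?t m (k + 1) - ?t m k) / 2)"
    using lamM_range[OF _ _ Suc.IH[OF k]] by auto
  show ?case
  proof (cases "even i")
    case True
    then have "i = 2 * k"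
      by (simp add: k_def)
    then show ?thesis
      using mid(1) unfolding half by simp
  next
    case False
    then have "i = 2 * k + 1"
      by (simp add: k_def)
    then show ?thesis
      using mid(2) unfolding half by simp
  qed
qed

lemma grid_lipschitz_level:
  assumes "0 \<le> r" "r < s" "\<bar>b - a\<bar> \<le> c * (s - r)" "\<And>t. t \<in> V r s \<Longrightarrow> \<omega> t \<in> {0..1}"
    and "i \<le> j" "j \<le> 2 ^ m"
  shows "\<bar>grid lamM r a s b \<omega> m j - grid lamM r a s b \<omega> m i\<bar>
    \<le> c * (dyadic r s m j - dyadic r s m i)"
  using assms(5,6)
proof (induction j rule: dec_induct)
  case (step n)
  then show ?case
    using grid_adjacent[where \<omega> = \<omega> and m = m and i = n, OF assms(1-4)] by (simp add: right_diff_distrib)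
qed simp

text \<open>
  Refining both points to the common level \<open>m + n\<close> reduces the claim to one level. For equal points
  it says that the grid values define a function on the dyadic points.
\<close>

lemma grid_lipschitz:
  assumes "0 \<le> r" "r < s" "\<bar>b - a\<bar> \<le> c * (s - r)" "\<And>t. t \<in> V r s \<Longrightarrow> \<omega> t \<in> {0..1}"
    and "i \<le> 2 ^ m" "j \<le> 2 ^ n"
  shows "\<bar>grid lamM r a s b \<omega> m i - grid lamM r a s b \<omega> n j\<bar>
    \<le> c * \<bar>dyadic r s m i - dyadic r s n j\<bar>"
proof -
  define i' j' N where "i' = 2 ^ n * i" and "j' = 2 ^ m * j" and "N = m + n"
  have eq: "grid lamM r a s b \<omega> m i = grid lamM r a s b \<omega> N i'"
      "grid lamM r a s b \<omega> n j = grid lamM r a s b \<omega> N j'"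
      "dyadic r s m i = dyadic r s N i'" "dyadic r s n j = dyadic r s N j'"
    using grid_refine[of r a s b \<omega> m n i] grid_refine[of r a s b \<omega> n m j]
      dyadic_refine[of r s m n i] dyadic_refine[of r s n m j]
    by (simp_all add: i'_def j'_def N_def add.commute)
  have le: "i' \<le> 2 ^ N" "j' \<le> 2 ^ N"
    using assms(5,6) by (simp_all add: i'_def j'_def N_def power_add mult.commute)
  show ?thesis
  proof (cases "i' \<le> j'")
    case True
    then have "dyadic r s N i' \<le> dyadic r s N j'"
      using dyadic_strict_mono[OF assms(2), of i' j' N] by (cases "i' = j'") auto
    with grid_lipschitz_level[where \<omega> = \<omega>, OF assms(1-4) True le(2)] show ?thesis
      by (simp add: eq abs_minus_commute)
  next
    case False
    then have "dyadic r s N j' \<le> dyadic r s N i'"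
      using dyadic_strict_mono[OF assms(2), of j' i' N] by auto
    with grid_lipschitz_level[where \<omega> = \<omega> and i = j', OF assms(1-4) _ le(1)] False show ?thesis
      by (simp add: eq)
  qed
qed

lemma phi_bridge_eqI:
  assumes "r < s" "x \<in> extensional {r..s}" "continuous_on {r..s} x"
    and "\<And>m i. i \<le> 2 ^ m \<Longrightarrow> x (dyadic r s m i) = grid lamM r a s b \<omega> m i"
  shows "phi_bridge lamM r a s b \<omega> = x"
  unfolding phi_bridge_def
proof (rule the_equality)
  show "x \<in> extensional {r..s} \<and> continuous_on {r..s} x \<and>
        (\<forall>m. \<forall>i \<le> 2 ^ m. x (dyadic r s m i) = grid lamM r a s b \<omega> m i)"
    using assms by blast
  fix y assume y: "y \<in> extensional {r..s} \<and> continuous_on {r..s} y \<and>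
        (\<forall>m. \<forall>i \<le> 2 ^ m. y (dyadic r s m i) = grid lamM r a s b \<omega> m i)"
  have "y t - x t = 0" if "t \<in> {r..s}" for t
  proof (rule continuous_constant_on_closure[of "dyadics_of r s" "\<lambda>t. y t - x t"])
    show "continuous_on (closure (dyadics_of r s)) (\<lambda>t. y t - x t)"
      using assms y by (auto simp: closure_dyadics_of intro!: continuous_intros)
    show "\<And>u. u \<in> dyadics_of r s \<Longrightarrow> y u - x u = 0"
      using assms y by (auto simp: dyadics_of_def)
    show "t \<in> closure (dyadics_of r s)"
      using assms that by (simp add: closure_dyadics_of)
  qed
  then show "y = x"
    using y assms(2) by (intro extensionalityI[of _ "{r..s}"]) auto
qed

text \<open>
  The path is obtained by extending the Lipschitz function of grid values from the dyadic points to
  their closure.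
\<close>

lemma phi_bridge_extends_grid:
  assumes "0 \<le> r" "r < s" "\<bar>b - a\<bar> \<le> c * (s - r)" "\<And>t. t \<in> V r s \<Longrightarrow> \<omega> t \<in> {0..1}"
  shows "phi_bridge lamM r a s b \<omega> \<in> topspace (Lambda c r s)"
    and "i \<le> 2 ^ m \<Longrightarrow> phi_bridge lamM r a s b \<omega> (dyadic r s m i) = grid lamM r a s b \<omega> m i"
proof -
  define g where "g t = (SOME v. \<exists>m i. i \<le> 2 ^ m \<and> t = dyadic r s m i \<and> v = grid lamM r a s b \<omega> m i)"
    for t
  have g: "g (dyadic r s m i) = grid lamM r a s b \<omega> m i" if "i \<le> 2 ^ m" for m i
    unfolding g_def
  proof (rule some_equality)
    fix v assume "\<exists>n j. j \<le> 2 ^ n \<and> dyadic r s m i = dyadic r s n j \<and> v = grid lamM r a s b \<omega> n j"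
    then show "v = grid lamM r a s b \<omega> m i"
      using grid_lipschitz[where \<omega> = \<omega>, OF assms that] by fastforce
  qed (use that in blast)
  have "c-lipschitz_on (dyadics_of r s) g"
    using c_pos grid_lipschitz[where \<omega> = \<omega>, OF assms]
    by (intro lipschitz_onI) (auto simp: dyadics_of_def g dist_real_def)
  then obtain h where h: "c-lipschitz_on {r..s} h" "\<And>t. t \<in> dyadics_of r s \<Longrightarrow> h t = g t"
    using lipschitz_extend_closure closure_dyadics_of[OF assms(2)] by metis
  define x where "x = restrict h {r..s}"
  have lip: "c-lipschitz_on {r..s} x"
    using lipschitz_on_transform[OF h(1), of x] by (simp add: x_def)
  have "x (dyadic r s m i) = grid lamM r a s b \<omega> m i" if "i \<le> 2 ^ m" for m i
  proof -
    have "dyadic r s m i \<in> dyadics_of r s" "dyadic r s m i \<in> {r..s}"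
      using that assms by (auto simp: dyadics_of_def dyadic_ge dyadic_le)
    then show ?thesis
      using h(2) g[OF that] by (simp add: x_def)
  qed
  moreover from this have "phi_bridge lamM r a s b \<omega> = x"
    using assms(2) lipschitz_on_continuous_on[OF lip] by (intro phi_bridge_eqI) (auto simp: x_def)
  ultimately show "phi_bridge lamM r a s b \<omega> \<in> topspace (Lambda c r s)"
    and "i \<le> 2 ^ m \<Longrightarrow> phi_bridge lamM r a s b \<omega> (dyadic r s m i) = grid lamM r a s b \<omega> m i"
    using lip by (auto simp: topspace_Lambda x_def)
qed

lemma continuous_map_grid:
  assumes rs: "0 \<le> r" "r < s"
    and cont: "continuous_map X euclideanreal A" "continuous_map X euclideanreal B"
      "\<And>t. t \<in> V r s \<Longrightarrow> continuous_map X (top_of_set {0..1}) (\<lambda>x. W x t)"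
    and adm: "\<And>x. x \<in> topspace X \<Longrightarrow> \<bar>B x - A x\<bar> \<le> c * (s - r)"
    and i: "i \<le> 2 ^ m"
  shows "continuous_map X euclideanreal (\<lambda>x. grid lamM r (A x) s (B x) (W x) m i)"
  using i
proof (induction m arbitrary: i)
  case 0
  then show ?case
    using cont by (cases "i = 0") simp_all
next
  case (Suc m)
  define k where "k = i div 2"
  show ?case
  proof (cases "even i")
    case True
    then show ?thesis
      using Suc.IH[of k] Suc.prems by (auto simp: k_def)
  next
    case False
    then have i: "i = 2 * k + 1" and k: "k < 2 ^ m"
      using Suc.prems by (auto simp: k_def elim!: oddE)
    have W: "W x t \<in> {0..1}" if "x \<in> topspace X" "t \<in> V r s" for x t
      using cont(3)[OF that(2)] that(1) by (auto simp: continuous_map_in_subtopology)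
    have "continuous_map X euclideanreal (\<lambda>x. lamM (dyadic r s m k) (grid lamM r (A x) s (B x) (W x) m k)
        (dyadic r s m (k + 1)) (grid lamM r (A x) s (B x) (W x) m (k + 1)) (W x (dyadic r s (Suc m) i)))"
    proof (intro continuous_map_lamM)
      show "0 \<le> dyadic r s m k" "dyadic r s m k < dyadic r s m (k + 1)"
        using rs dyadic_ge[of r s m k] dyadic_strict_mono[of r s k "k + 1" m] by auto
      show "continuous_map X (top_of_set {0..1}) (\<lambda>x. W x (dyadic r s (Suc m) i))"
        using i k by (intro cont(3) dyadic_odd_in_V) auto
    qed (use k Suc.IH grid_adjacent[OF rs adm W] in auto)
    then show ?thesis
      using False by (simp add: k_def)
  qed
qed

text \<open>
  At every midpoint \<open>x\<close> satisfies the two slope bounds that describe the range of the midpoint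
  map, so some parameter yields the value of \<open>x\<close> there. With these parameters as coordinates of
  \<open>\<omega>\<close>, the recursion reproduces \<open>x\<close> by induction on the level.
\<close>

lemma grid_onto:
  assumes rs: "0 \<le> r" "r < s" and x: "x \<in> topspace (Lambda c r s)"
  obtains \<omega> where "\<And>t. t \<in> V r s \<Longrightarrow> \<omega> t \<in> {0..1}"
    "\<And>m i. i \<le> 2 ^ m \<Longrightarrow> grid lamM r (x r) s (x s) \<omega> m i = x (dyadic r s m i)"
proof -
  let ?t = "dyadic r s"
  have lip: "\<bar>x u - x v\<bar> \<le> c * \<bar>u - v\<bar>" if "u \<in> {r..s}" "v \<in> {r..s}" for u v
    using x lipschitz_onD[of c "{r..s}" x u v] that by (simp add: topspace_Lambda dist_real_def)
  define good where "good m k \<xi> \<longleftrightarrow> \<xi> \<in> {0..1} \<and>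
      lamM (?t m k) (x (?t m k)) (?t m (k + 1)) (x (?t m (k + 1))) \<xi> = x (?t (Suc m) (2 * k + 1))"
    for m k \<xi>
  have good: "\<exists>\<xi>. good m k \<xi>" if k: "k < 2 ^ m" for m k
  proof -
    let ?u = "?t m k" and ?v = "?t m (k + 1)" and ?w = "?t (Suc m) (2 * k + 1)"
    have mem: "?u \<in> {r..s}" "?v \<in> {r..s}" "?w \<in> {r..s}"
      using rs k by (auto intro!: dyadic_ge dyadic_le)
    have uv: "?u < ?v"
      using rs by (intro dyadic_strict_mono) auto
    have w: "?w - ?u = (?v - ?u) / 2" "?v - ?w = (?v - ?u) / 2"
      unfolding dyadic_mid by (simp_all add: field_simps)
    have "0 \<le> ?w - ?u" "0 \<le> ?v - ?w"
      unfolding w using uv by simp_all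
    then have "\<bar>x ?v - x ?u\<bar> \<le> c * (?v - ?u)" "\<bar>x ?w - x ?u\<bar> \<le> c * (?w - ?u)"
        "\<bar>x ?v - x ?w\<bar> \<le> c * (?v - ?w)"
      using lip[of ?v ?u] lip[of ?w ?u] lip[of ?v ?w] mem uv by simp_all
    then have "x ?w \<in> lamM ?u (x ?u) ?v (x ?v) ` {0..1}"
      unfolding w using uv mem rs by (subst lamM_range) auto
    then show ?thesis
      by (auto simp: good_def)
  qed
  define P where "P u \<xi> \<longleftrightarrow> (\<exists>m k. k < 2 ^ m \<and> u = ?t (Suc m) (2 * k + 1) \<and> good m k \<xi>)" for u \<xi>
  \<comment> \<open>The default \<open>0\<close> makes \<open>\<omega>\<close> take values in the unit interval everywhere.\<close>
  define \<omega> where "\<omega> u = (if \<exists>\<xi>. P u \<xi> then SOME \<xi>. P u \<xi> else 0)" for u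
  have P\<omega>: "P u (\<omega> u)" if "\<exists>\<xi>. P u \<xi>" for u
    using that by (simp add: \<omega>_def someI_ex)
  have \<omega>: "good m k (\<omega> (?t (Suc m) (2 * k + 1)))" if "k < 2 ^ m" for m k
  proof -
    have "\<exists>\<xi>. P (?t (Suc m) (2 * k + 1)) \<xi>"
      using good that unfolding P_def by blast
    from P\<omega>[OF this] obtain m' k' where "?t (Suc m) (2 * k + 1) = ?t (Suc m') (2 * k' + 1)"
        "good m' k' (\<omega> (?t (Suc m) (2 * k + 1)))"
      unfolding P_def by blast
    then show ?thesis
      using dyadic_odd_unique[OF rs(2), of "2 * k + 1" "2 * k' + 1" m m'] by auto
  qed
  have grid: "grid lamM r (x r) s (x s) \<omega> m i = x (?t m i)" if "i \<le> 2 ^ m" for m i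
    using that
  proof (induction m arbitrary: i)
    case 0
    then have "i = 0 \<or> i = 1"
      by auto
    then show ?case
      by (auto simp: dyadic_def)
  next
    case (Suc m)
    define k where "k = i div 2"
    show ?case
    proof (cases "even i")
      case True
      then have "i = 2 * k"
        by (simp add: k_def)
      then show ?thesis
        using Suc by (simp add: dyadic_double)
    next
      case False
      then have i: "i = 2 * k + 1" and k: "k < 2 ^ m"
        using Suc.prems by (auto simp: k_def elim!: oddE)
      then show ?thesis
        using \<omega>[OF k] Suc.IH[of k] Suc.IH[of "k + 1"] by (simp add: good_def)
    qed
  qed
  have "\<omega> u \<in> {0..1}" for u
  proof (cases "\<exists>\<xi>. P u \<xi>")
    case True
    then show ?thesis
      using P\<omega>[of u] by (auto simp: P_def good_def)
  next
    case False
    then have "\<omega> u = 0"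
      unfolding \<omega>_def by (rule if_not_P)
    then show ?thesis
      by simp
  qed
  then show thesis
    using that grid by blast
qed

lemma grid_cong:
  assumes "\<And>t. t \<in> V r s \<Longrightarrow> \<omega> t = \<omega>' t" "i \<le> 2 ^ m"
  shows "grid lamM r a s b \<omega> m i = grid lamM r a s b \<omega>' m i"
  using assms(2)
proof (induction m arbitrary: i)
  case (Suc m)
  then have "odd i \<Longrightarrow> i div 2 + 1 \<le> 2 ^ m" "i div 2 \<le> 2 ^ m"
    by (auto elim!: oddE)
  moreover have "odd i \<Longrightarrow> dyadic r s (Suc m) i \<in> V r s"
    using Suc.prems by (intro dyadic_odd_in_V) (auto simp: le_less)
  ultimately show ?case
    using Suc.IH assms(1) by auto
qed simp


section \<open>Paths with a free end point\<close>

lemma V_subset_V_hat: "t \<in> V r s \<Longrightarrow> t \<in> V_hat r s"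
  by (simp add: V_hat_def)

lemma end_in_V_hat: "s \<in> V_hat r s"
  by (simp add: V_hat_def)

lemma phi_from_cong:
  assumes "\<And>t. t \<in> V_hat r s \<Longrightarrow> \<omega> t = \<omega>' t"
  shows "phi_from lamM lamE r a s \<omega> = phi_from lamM lamE r a s \<omega>'"
proof -
  have "restrict \<omega> (V r s) = restrict \<omega>' (V r s)"
    using assms V_subset_V_hat by (intro restrict_ext) blast
  then show ?thesis
    using assms[OF end_in_V_hat] by (simp add: phi_from_def)
qed

lemma lamE_admissible:
  assumes "0 \<le> r" "r < s" "\<xi> \<in> {0..1}"
  shows "\<bar>lamE r a s \<xi> - a\<bar> \<le> c * (s - r)"
  using lamE_range[OF assms(1,2), of a] assms(3) by blast

lemma
  assumes "0 \<le> r" "r < s" "\<And>t. t \<in> V_hat r s \<Longrightarrow> \<omega> t \<in> {0..1}"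
  shows phi_from_in_Lambda: "phi_from lamM lamE r a s \<omega> \<in> topspace (Lambda c r s)"
    and phi_from_start: "phi_from lamM lamE r a s \<omega> r = a"
proof -
  have adm: "\<bar>lamE r a s (\<omega> s) - a\<bar> \<le> c * (s - r)"
    using assms end_in_V_hat by (intro lamE_admissible) auto
  have \<omega>: "restrict \<omega> (V r s) t \<in> {0..1}" if "t \<in> V r s" for t
    using that assms(3)[OF V_subset_V_hat[OF that]] by simp
  show "phi_from lamM lamE r a s \<omega> \<in> topspace (Lambda c r s)"
    unfolding phi_from_def by (rule phi_bridge_extends_grid(1)[OF assms(1,2) adm \<omega>])
  show "phi_from lamM lamE r a s \<omega> r = a"
    using phi_bridge_extends_grid(2)[where \<omega> = "restrict \<omega> (V r s)" and i = 0 and m = 0,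
        OF assms(1,2) adm \<omega>]
    by (simp add: phi_from_def)
qed

lemma
  assumes rs: "0 \<le> r" "r < s"
    and cont: "continuous_map X euclideanreal A"
      "\<And>t. t \<in> V_hat r s \<Longrightarrow> continuous_map X (top_of_set {0..1}) (\<lambda>x. W x t)"
  shows continuous_map_phi_from:
      "continuous_map X (Lambda c r s) (\<lambda>x. phi_from lamM lamE r (A x) s (W x))"
    and continuous_map_phi_from_eval:
      "t \<in> {r..s} \<Longrightarrow> continuous_map X euclideanreal (\<lambda>x. phi_from lamM lamE r (A x) s (W x) t)"
proof -
  define B where "B x = lamE r (A x) s (W x s)" for x
  have W: "W x t \<in> {0..1}" if "x \<in> topspace X" "t \<in> V_hat r s" for x t
    using cont(2)[OF that(2)] that(1) by (auto simp: continuous_map_in_subtopology)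
  have B: "continuous_map X euclideanreal B"
    unfolding B_def using rs cont end_in_V_hat by (intro continuous_map_lamE) auto
  have adm: "\<bar>B x - A x\<bar> \<le> c * (s - r)" if "x \<in> topspace X" for x
    unfolding B_def using rs W[OF that end_in_V_hat] by (rule lamE_admissible)
  have in_Lambda: "phi_from lamM lamE r (A x) s (W x) \<in> topspace (Lambda c r s)"
    if "x \<in> topspace X" for x
    using rs W[OF that] by (rule phi_from_in_Lambda)
  have dyad: "continuous_map X euclideanreal (\<lambda>x. phi_from lamM lamE r (A x) s (W x) t)"
    if t: "t \<in> dyadics_of r s" for t
  proof -
    obtain m i where i: "i \<le> 2 ^ m" "t = dyadic r s m i"
      using t by (auto simp: dyadics_of_def)
    have "continuous_map X euclideanreal (\<lambda>x. grid lamM r (A x) s (B x) (W x) m i)"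
      using rs cont(1) B cont(2)[OF V_subset_V_hat] adm i(1) by (rule continuous_map_grid)
    moreover have "phi_from lamM lamE r (A x) s (W x) t = grid lamM r (A x) s (B x) (W x) m i"
      if "x \<in> topspace X" for x
    proof -
      have "restrict (W x) (V r s) u \<in> {0..1}" if "u \<in> V r s" for u
        using that W[OF \<open>x \<in> topspace X\<close> V_subset_V_hat[OF that]] by simp
      then have "phi_bridge lamM r (A x) s (B x) (restrict (W x) (V r s)) t
          = grid lamM r (A x) s (B x) (restrict (W x) (V r s)) m i"
        unfolding i(2) by (rule phi_bridge_extends_grid(2)[OF rs adm[OF that] _ i(1)])
      also have "\<dots> = grid lamM r (A x) s (B x) (W x) m i"
        using i(1) by (intro grid_cong) auto
      finally show ?thesis
        by (simp add: phi_from_def B_def)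
    qed
    ultimately show ?thesis
      by (metis (no_types, lifting) continuous_map_eq)
  qed
  have sub: "{r..s} \<subseteq> closure (dyadics_of r s)" "dyadics_of r s \<subseteq> {r..s}"
    using closure_dyadics_of[OF rs(2)] closure_subset[of "dyadics_of r s"] by auto
  show "continuous_map X (Lambda c r s) (\<lambda>x. phi_from lamM lamE r (A x) s (W x))"
    using c_pos sub in_Lambda dyad by (rule continuous_map_into_Lambda)
  show "continuous_map X euclideanreal (\<lambda>x. phi_from lamM lamE r (A x) s (W x) t)"
    if t: "t \<in> {r..s}"
    using c_pos sub t _ dyad
  proof (rule continuous_map_eval_lipschitz)
    fix x assume "x \<in> topspace X"
    then show "c-lipschitz_on {r..s} (phi_from lamM lamE r (A x) s (W x))"
      using in_Lambda by (simp add: topspace_Lambda)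
  qed
qed

text \<open>
  The end point \<open>s\<close> is not one of the interior dyadic points, so its coordinate can be chosen
  to hit \<open>x s\<close> without disturbing the bridge.
\<close>

lemma phi_from_onto:
  assumes rs: "0 \<le> r" "r < s" and x: "x \<in> topspace (Lambda c r s)"
  obtains \<omega> where "\<omega> \<in> topspace (cube (V_hat r s))" "phi_from lamM lamE r (x r) s \<omega> = x"
proof -
  have lip: "c-lipschitz_on {r..s} x"
    using x by (simp add: topspace_Lambda)
  obtain \<omega> where \<omega>: "\<And>t. t \<in> V r s \<Longrightarrow> \<omega> t \<in> {0..1}"
      "\<And>m i. i \<le> 2 ^ m \<Longrightarrow> grid lamM r (x r) s (x s) \<omega> m i = x (dyadic r s m i)"
    using grid_onto[OF rs x] by blast
  have "\<bar>x s - x r\<bar> \<le> c * (s - r)"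
    using lipschitz_onD[OF lip, of s r] rs by (simp add: dist_real_def)
  then obtain \<xi> where \<xi>: "\<xi> \<in> {0..1}" "lamE r (x r) s \<xi> = x s"
    using lamE_range[OF rs, of "x r"] by (metis (mono_tags, lifting) imageE mem_Collect_eq)
  define \<omega>' where "\<omega>' = (\<lambda>t\<in>V_hat r s. if t = s then \<xi> else \<omega> t)"
  have s: "s \<notin> V r s"
    using V_subset_Ioo[OF rs(2)] by auto
  have "phi_bridge lamM r (x r) s (x s) (restrict \<omega>' (V r s)) = x"
  proof (rule phi_bridge_eqI[OF rs(2)])
    show "x \<in> extensional {r..s}" "continuous_on {r..s} x"
      using x lip lipschitz_on_continuous_on by (auto simp: topspace_Lambda)
    fix m i :: nat assume i: "i \<le> 2 ^ m"
    then have "grid lamM r (x r) s (x s) (restrict \<omega>' (V r s)) m i = grid lamM r (x r) s (x s) \<omega> m i"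
      using s by (intro grid_cong) (auto simp: \<omega>'_def V_hat_def)
    then show "x (dyadic r s m i) = grid lamM r (x r) s (x s) (restrict \<omega>' (V r s)) m i"
      using \<omega>(2)[OF i] by simp
  qed
  then have "phi_from lamM lamE r (x r) s \<omega>' = x"
    using \<xi> by (simp add: phi_from_def \<omega>'_def V_hat_def)
  moreover have "\<omega>' \<in> topspace (cube (V_hat r s))"
    using \<omega>(1) \<xi>(1) by (auto simp: topspace_cube V_hat_def \<omega>'_def)
  ultimately show thesis
    using that by blast
qed

end


section \<open>Paths on a half-line\<close>

text \<open>
  Counting the first piece, which ends at the next integer, together with the unit intervals after
  it gives a single sequence, so that all pieces are treated alike.
\<close>

definition breakpoint :: "real \<Rightarrow> nat \<Rightarrow> real" where
  "breakpoint r k = (case k of 0 \<Rightarrow> r | Suc j \<Rightarrow> real (next_int r + j))"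

lemma breakpoint_0 [simp]: "breakpoint r 0 = r"
  by (simp add: breakpoint_def)

lemma breakpoint_less_Suc: "breakpoint r k < breakpoint r (Suc k)"
proof -
  have "r < real (next_int r)"
    unfolding next_int_def using reals_Archimedean2 by (rule LeastI_ex)
  then show ?thesis
    by (cases k) (simp_all add: breakpoint_def)
qed

lemma strict_mono_breakpoint: "strict_mono (breakpoint r)"
  using breakpoint_less_Suc by (simp add: strict_mono_Suc_iff)

lemma breakpoint_ge: "r \<le> breakpoint r k"
  using strict_mono_less_eq[OF strict_mono_breakpoint, of r 0 k] by simp

lemma breakpoint_unbounded: "\<exists>k. t \<le> breakpoint r k"
proof -
  obtain j where "t \<le> real j"
    using real_arch_simple by blast
  then show ?thesis
    by (intro exI[of _ "Suc j"]) (simp add: breakpoint_def)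
qed

lemma breakpoint_cover:
  assumes "r \<le> t"
  obtains k where "t \<in> {breakpoint r k..breakpoint r (Suc k)}"
proof -
  define n where "n = (LEAST n. t \<le> breakpoint r n)"
  have n: "t \<le> breakpoint r n"
    unfolding n_def using breakpoint_unbounded by (rule LeastI_ex)
  show thesis
  proof (cases n)
    case 0
    then have "t = breakpoint r 0"
      using n assms by simp
    then show ?thesis
      using that[of 0] breakpoint_less_Suc[of r 0] by simp
  next
    case (Suc k)
    then have "\<not> t \<le> breakpoint r k"
      using not_less_Least[of k "\<lambda>n. t \<le> breakpoint r n"] by (simp add: n_def)
    then show ?thesis
      using that[of k] n Suc by simp
  qed
qed

lemma V_hat_ray_breakpoint: "V_hat_ray r = (\<Union>k. V_hat (breakpoint r k) (breakpoint r (Suc k)))"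
proof -
  have "(\<Union>j\<in>{next_int r..}. V_hat (real j) (real (j + 1)))
      = (\<Union>i. V_hat (breakpoint r (Suc i)) (breakpoint r (Suc (Suc i))))"
  proof -
    have "{next_int r..} = range (\<lambda>i. next_int r + i)"
      by (auto simp: image_iff le_iff_add)
    then show ?thesis
      by (simp add: breakpoint_def ac_simps)
  qed
  moreover have "(\<Union>k. V_hat (breakpoint r k) (breakpoint r (Suc k)))
      = V_hat r (breakpoint r (Suc 0)) \<union> (\<Union>i. V_hat (breakpoint r (Suc i)) (breakpoint r (Suc (Suc i))))"
    by (subst UNIV_nat_eq) simp
  ultimately show ?thesis
    by (simp add: V_hat_ray_def breakpoint_def)
qed

lemma V_hat_breakpoint_disjoint:
  assumes "t \<in> V_hat (breakpoint r k) (breakpoint r (Suc k))"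
    "t \<in> V_hat (breakpoint r l) (breakpoint r (Suc l))"
  shows "k = l"
proof -
  have "t \<in> {breakpoint r k<..breakpoint r (Suc k)}" if "t \<in> V_hat (breakpoint r k) (breakpoint r (Suc k))" for k
    using that V_subset_Ioo[OF breakpoint_less_Suc[of r k]] breakpoint_less_Suc[of r k]
    by (auto simp: V_hat_def)
  from this[OF assms(1)] this[OF assms(2)]
  have "breakpoint r k < breakpoint r (Suc l)" "breakpoint r l < breakpoint r (Suc k)"
    by auto
  then show ?thesis
    using strict_mono_less[OF strict_mono_breakpoint] by (meson less_Suc_eq_le le_antisym)
qed

context path_selection
begin

text \<open>
  The conditions that determine \<open>phi_ray_from\<close>, rewritten along the breakpoints: each piece starts
  where the preceding one ended.
\<close>

definition ray_path :: "real \<Rightarrow> real \<Rightarrow> (real \<Rightarrow> real) \<Rightarrow> (real \<Rightarrow> real) \<Rightarrow> bool" where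
  "ray_path r a \<omega> x \<longleftrightarrow> x \<in> extensional {r..} \<and> x r = a \<and>
     (\<forall>k. \<forall>t\<in>{breakpoint r k..breakpoint r (Suc k)}.
        x t = phi_from lamM lamE (breakpoint r k) (x (breakpoint r k)) (breakpoint r (Suc k)) \<omega> t)"

lemma ray_path_unique:
  assumes "ray_path r a \<omega> x" "ray_path r a \<omega> y"
  shows "x = y"
proof (rule extensionalityI)
  have eq: "x (breakpoint r k) = y (breakpoint r k)" for k
  proof (induction k)
    case (Suc k)
    have "breakpoint r (Suc k) \<in> {breakpoint r k..breakpoint r (Suc k)}"
      using breakpoint_less_Suc[of r k] by simp
    then show ?case
      using assms Suc unfolding ray_path_def by metis
  qed (use assms in \<open>simp add: ray_path_def\<close>)
  fix t assume "t \<in> {r..}"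
  then obtain k where "t \<in> {breakpoint r k..breakpoint r (Suc k)}"
    using breakpoint_cover by auto
  then show "x t = y t"
    using assms eq[of k] by (simp add: ray_path_def)
qed (use assms in \<open>auto simp: ray_path_def\<close>)

text \<open>
  The values \<open>d k\<close> at the breakpoints are computed recursively, each as the end point of a piece,
  and then the pieces are glued. Adjacent pieces agree at their common breakpoint because a piece
  starts at its prescribed starting value.
\<close>

lemma ray_path_exists:
  assumes r: "0 \<le> r" and \<omega>: "\<And>t. t \<in> V_hat_ray r \<Longrightarrow> \<omega> t \<in> {0..1}"
  shows "\<exists>x. ray_path r a \<omega> x"
proof -
  let ?b = "breakpoint r"
  define p where "p k d = phi_from lamM lamE (?b k) d (?b (Suc k)) \<omega>" for k d
  define d where "d = rec_nat a (\<lambda>k v. p k v (?b (Suc k)))"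
  have d: "d 0 = a" "d (Suc k) = p k (d k) (?b (Suc k))" for k
    by (simp_all add: d_def)
  have start: "p k v (?b k) = v" for k v
    unfolding p_def
    using r breakpoint_ge[of r k] breakpoint_less_Suc[of r k] \<omega>
    by (intro phi_from_start) (auto simp: V_hat_ray_breakpoint)
  define x where "x = restrict (\<lambda>t. let k = (LEAST k. t \<le> ?b (Suc k)) in p k (d k) t) {r..}"
  have x_piece: "x t = p k (d k) t" if t: "?b k \<le> t" "t \<le> ?b (Suc k)" for k t
  proof -
    have x: "x t = p (LEAST k. t \<le> ?b (Suc k)) (d (LEAST k. t \<le> ?b (Suc k))) t"
      using t breakpoint_ge[of r k] by (simp add: x_def Let_def)
    \<comment> \<open>At an interior breakpoint the least index selects the piece that ends there.\<close>
    show ?thesis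
    proof (cases "t = ?b k \<and> k \<noteq> 0")
      case True
      then obtain l where l: "k = Suc l"
        using not0_implies_Suc by blast
      have "(LEAST k. t \<le> ?b (Suc k)) = l"
        using True l strict_mono_less_eq[OF strict_mono_breakpoint, of r]
        by (intro Least_equality) auto
      then show ?thesis
        using x True start[of k "d k"] d(2)[of l] l by simp
    next
      case False
      have "(LEAST k. t \<le> ?b (Suc k)) = k"
      proof (rule Least_equality)
        fix l assume "t \<le> ?b (Suc l)"
        show "k \<le> l"
        proof (rule ccontr)
          assume "\<not> k \<le> l"
          then have "?b (Suc l) \<le> ?b k"
            using strict_mono_less_eq[OF strict_mono_breakpoint, of r] by auto
          then show False
            using False t \<open>t \<le> ?b (Suc l)\<close> \<open>\<not> k \<le> l\<close> by auto
        qed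
      qed (rule t)
      then show ?thesis
        using x by simp
    qed
  qed
  have x_b: "x (?b k) = d k" for k
    using x_piece[of k "?b k"] start breakpoint_less_Suc[of r k] by simp
  have "ray_path r a \<omega> x"
    unfolding ray_path_def
  proof (intro conjI allI ballI)
    show "x \<in> extensional {r..}"
      by (simp add: x_def)
    show "x r = a"
      using x_b[of 0] d(1) by simp
    show "x t = phi_from lamM lamE (?b k) (x (?b k)) (?b (Suc k)) \<omega> t" if "t \<in> {?b k..?b (Suc k)}" for k t
      using x_piece[of k t] x_b[of k] that by (simp add: p_def)
  qed
  then show ?thesis
    by blast
qed

lemma phi_ray_from_eqI:
  assumes r: "0 \<le> r" and x: "ray_path r a \<omega> x"
    and \<omega>: "\<And>t. t \<in> V_hat_ray r \<Longrightarrow> \<omega> t \<in> {0..1}"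
  shows "phi_ray_from lamM lamE r a \<omega> = x"
proof -
  let ?b = "breakpoint r" and ?m = "next_int r"
  have restr: "phi_from lamM lamE u v w (restrict \<omega> (V_hat u w)) = phi_from lamM lamE u v w \<omega>" for u v w
    by (rule phi_from_cong) simp
  have b1: "?b (Suc 0) = real ?m" and bSuc: "?b (Suc k) = real (?m + k)" for k
    by (simp_all add: breakpoint_def)
  have start: "phi_from lamM lamE r a (real ?m) \<omega> r = a"
  proof (rule phi_from_start[OF r])
    show "r < real ?m"
      using breakpoint_less_Suc[of r 0] b1 by simp
    show "\<And>t. t \<in> V_hat r (real ?m) \<Longrightarrow> \<omega> t \<in> {0..1}"
      using \<omega> by (simp add: V_hat_ray_def)
  qed
  have iff: "y \<in> extensional {r..} \<and>
        (\<forall>t\<in>{r..real ?m}. y t = phi_from lamM lamE r a (real ?m) \<omega> t) \<and>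
        (\<forall>j\<ge>?m. \<forall>t\<in>{real j..real (j + 1)}.
           y t = phi_from lamM lamE (real j) (y (real j)) (real (j + 1)) \<omega> t)
      \<longleftrightarrow> ray_path r a \<omega> y" for y
  proof -
    have split: "(\<forall>k. P k) \<longleftrightarrow> P 0 \<and> (\<forall>i. P (Suc i))" for P :: "nat \<Rightarrow> bool"
      by (metis nat.exhaust)
    have shift: "(\<forall>j\<ge>?m. P j) \<longleftrightarrow> (\<forall>i. P (?m + i))" for P :: "nat \<Rightarrow> bool"
      by (auto simp: le_iff_add)
    have pieces: "(\<forall>k. \<forall>t\<in>{?b k..?b (Suc k)}. y t = phi_from lamM lamE (?b k) (y (?b k)) (?b (Suc k)) \<omega> t)
      \<longleftrightarrow> (\<forall>t\<in>{r..real ?m}. y t = phi_from lamM lamE r (y r) (real ?m) \<omega> t) \<and>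
        (\<forall>j\<ge>?m. \<forall>t\<in>{real j..real (j + 1)}.
           y t = phi_from lamM lamE (real j) (y (real j)) (real (j + 1)) \<omega> t)"
      unfolding shift by (subst split) (simp add: b1 bSuc)
    have "y r = a" if "\<forall>t\<in>{r..real ?m}. y t = phi_from lamM lamE r a (real ?m) \<omega> t"
      using that start breakpoint_less_Suc[of r 0] b1 by auto
    then show ?thesis
      unfolding ray_path_def pieces by (cases "y r = a") (simp, blast)
  qed
  show ?thesis
    unfolding phi_ray_from_def Let_def restr iff
    using x ray_path_unique[OF _ x] by (rule the_equality)
qed

lemma
  assumes r: "0 \<le> r" and \<omega>: "\<And>t. t \<in> V_hat_ray r \<Longrightarrow> \<omega> t \<in> {0..1}"
  shows ray_path_phi_ray_from: "ray_path r a \<omega> (phi_ray_from lamM lamE r a \<omega>)"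
    and phi_ray_from_in_Lambda_ray: "phi_ray_from lamM lamE r a \<omega> \<in> topspace (Lambda_ray c r)"
proof -
  let ?b = "breakpoint r"
  obtain x where x: "ray_path r a \<omega> x"
    using ray_path_exists[where \<omega> = \<omega> and a = a, OF r \<omega>] by blast
  then have eq: "phi_ray_from lamM lamE r a \<omega> = x"
    using r \<omega> by (intro phi_ray_from_eqI)
  show "ray_path r a \<omega> (phi_ray_from lamM lamE r a \<omega>)"
    using x by (simp add: eq)
  have piece: "c-lipschitz_on {?b k..?b (Suc k)} x" for k
  proof -
    have "phi_from lamM lamE (?b k) (x (?b k)) (?b (Suc k)) \<omega> \<in> topspace (Lambda c (?b k) (?b (Suc k)))"
      using r breakpoint_ge[of r k] breakpoint_less_Suc[of r k] \<omega>
      by (intro phi_from_in_Lambda) (auto simp: V_hat_ray_breakpoint)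
    then have "c-lipschitz_on {?b k..?b (Suc k)} (phi_from lamM lamE (?b k) (x (?b k)) (?b (Suc k)) \<omega>)"
      by (simp add: topspace_Lambda)
    then show ?thesis
      using x unfolding ray_path_def by (elim lipschitz_on_transform) blast
  qed
  have initial: "c-lipschitz_on {r..?b k} x" for k
  proof (induction k)
    case 0
    then show ?case
      using c_pos by (simp add: lipschitz_on_def)
  next
    case (Suc k)
    show ?case
      using lipschitz_on_concat[OF Suc piece[of k] refl] by simp
  qed
  have "c-lipschitz_on {r..} x"
  proof (rule lipschitz_onI)
    fix u v assume uv: "u \<in> {r..}" "v \<in> {r..}"
    obtain k where "max u v \<le> ?b k"
      using breakpoint_unbounded by blast
    then show "dist (x u) (x v) \<le> c * dist u v"
      using lipschitz_onD[OF initial[of k]] uv by simp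
  qed (use c_pos in simp)
  then show "phi_ray_from lamM lamE r a \<omega> \<in> topspace (Lambda_ray c r)"
    using x by (simp add: eq topspace_Lambda_ray ray_path_def)
qed

text \<open>
  The starting value of a piece is not an independent parameter but the value of the path at the
  preceding breakpoint. It depends continuously on the data by induction, and the continuity of
  \<open>phi_from\<close> jointly in the starting point and the coordinates propagates this to the whole piece.
\<close>

lemma continuous_map_phi_ray_from:
  assumes r: "0 \<le> r"
    and A: "continuous_map X euclideanreal A"
    and W: "\<And>t. t \<in> V_hat_ray r \<Longrightarrow> continuous_map X (top_of_set {0..1}) (\<lambda>x. W x t)"
  shows "continuous_map X (Lambda_ray c r) (\<lambda>x. phi_ray_from lamM lamE r (A x) (W x))"
proof -
  let ?b = "breakpoint r" and ?\<Phi> = "\<lambda>x. phi_ray_from lamM lamE r (A x) (W x)"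
  have W01: "W x t \<in> {0..1}" if "x \<in> topspace X" "t \<in> V_hat_ray r" for x t
    using W[OF that(2)] that(1) by (auto simp: continuous_map_in_subtopology)
  have path: "ray_path r (A x) (W x) (?\<Phi> x)" if "x \<in> topspace X" for x
    using r W01[OF that] by (rule ray_path_phi_ray_from)
  have step: "continuous_map X euclideanreal (\<lambda>x. ?\<Phi> x t)"
    if k: "continuous_map X euclideanreal (\<lambda>x. ?\<Phi> x (?b k))" and t: "t \<in> {?b k..?b (Suc k)}" for k t
  proof -
    have "continuous_map X euclideanreal
        (\<lambda>x. phi_from lamM lamE (?b k) (?\<Phi> x (?b k)) (?b (Suc k)) (W x) t)"
      using _ breakpoint_less_Suc k _ t
    proof (rule continuous_map_phi_from_eval)
      show "0 \<le> ?b k"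
        using r breakpoint_ge[of r k] by simp
      show "\<And>t. t \<in> V_hat (?b k) (?b (Suc k)) \<Longrightarrow> continuous_map X (top_of_set {0..1}) (\<lambda>x. W x t)"
        using W by (auto simp: V_hat_ray_breakpoint)
    qed
    moreover have "phi_from lamM lamE (?b k) (?\<Phi> x (?b k)) (?b (Suc k)) (W x) t = ?\<Phi> x t"
      if "x \<in> topspace X" for x
      using path[OF that] t unfolding ray_path_def by metis
    ultimately show ?thesis
      by (rule continuous_map_eq)
  qed
  have at_b: "continuous_map X euclideanreal (\<lambda>x. ?\<Phi> x (?b k))" for k
  proof (induction k)
    case 0
    have "A x = ?\<Phi> x (?b 0)" if "x \<in> topspace X" for x
      using path[OF that] by (simp add: ray_path_def)
    with A show ?case
      by (rule continuous_map_eq)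
  next
    case (Suc k)
    then show ?case
      using breakpoint_less_Suc[of r k] by (intro step) auto
  qed
  show ?thesis
  proof (rule continuous_map_into_Lambda_ray[OF c_pos])
    show "?\<Phi> x \<in> topspace (Lambda_ray c r)" if "x \<in> topspace X" for x
      using r W01[OF that] by (rule phi_ray_from_in_Lambda_ray)
    fix t assume "r \<le> t"
    then show "continuous_map X euclideanreal (\<lambda>x. ?\<Phi> x t)"
      using breakpoint_cover at_b step by metis
  qed
qed

text \<open>
  Each restriction of \<open>x\<close> to a piece is realised by some coordinates; since the coordinate sets of
  the pieces are disjoint, these choices fit together to one point of the cube.
\<close>

lemma phi_ray_from_onto:
  assumes r: "0 \<le> r" and x: "x \<in> topspace (Lambda_ray c r)"
  obtains \<omega> where "\<omega> \<in> topspace (cube (V_hat_ray r))" "phi_ray_from lamM lamE r (x r) \<omega> = x"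
proof -
  let ?b = "breakpoint r"
  define y where "y k = restrict x {?b k..?b (Suc k)}" for k
  have "\<exists>\<omega>. (\<forall>t\<in>V_hat (?b k) (?b (Suc k)). \<omega> t \<in> {0..1}) \<and>
      phi_from lamM lamE (?b k) (x (?b k)) (?b (Suc k)) \<omega> = y k" for k
  proof -
    have "c-lipschitz_on {?b k..?b (Suc k)} x"
      using x breakpoint_ge[of r k] lipschitz_on_subset[of c "{r..}" x "{?b k..?b (Suc k)}"]
      by (auto simp: topspace_Lambda_ray)
    then have "c-lipschitz_on {?b k..?b (Suc k)} (y k)"
      by (rule lipschitz_on_transform) (simp add: y_def)
    then have "y k \<in> topspace (Lambda c (?b k) (?b (Suc k)))"
      by (simp add: topspace_Lambda y_def)
    then obtain \<omega> where "\<omega> \<in> topspace (cube (V_hat (?b k) (?b (Suc k))))"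
        "phi_from lamM lamE (?b k) (y k (?b k)) (?b (Suc k)) \<omega> = y k"
      using phi_from_onto[of "?b k" "?b (Suc k)" "y k"] r breakpoint_ge[of r k] breakpoint_less_Suc[of r k]
      by auto
    moreover have "y k (?b k) = x (?b k)"
      using breakpoint_less_Suc[of r k] by (simp add: y_def)
    ultimately show ?thesis
      by (intro exI[of _ \<omega>]) (auto simp: topspace_cube PiE_iff)
  qed
  then obtain \<omega> where \<omega>: "\<And>k t. t \<in> V_hat (?b k) (?b (Suc k)) \<Longrightarrow> \<omega> k t \<in> {0..1}"
      "\<And>k. phi_from lamM lamE (?b k) (x (?b k)) (?b (Suc k)) (\<omega> k) = y k"
    by metis
  define \<omega>' where "\<omega>' = (\<lambda>t\<in>V_hat_ray r. \<omega> (SOME k. t \<in> V_hat (?b k) (?b (Suc k))) t)"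
  have \<omega>': "\<omega>' t = \<omega> k t" if "t \<in> V_hat (?b k) (?b (Suc k))" for k t
  proof -
    have "(SOME k. t \<in> V_hat (?b k) (?b (Suc k))) = k"
      using that V_hat_breakpoint_disjoint by (intro some_equality) blast+
    moreover have "t \<in> V_hat_ray r"
      using that by (auto simp: V_hat_ray_breakpoint)
    ultimately show ?thesis
      by (simp add: \<omega>'_def)
  qed
  have valid: "\<omega>' t \<in> {0..1}" if t: "t \<in> V_hat_ray r" for t
  proof -
    obtain k where k: "t \<in> V_hat (?b k) (?b (Suc k))"
      using t by (auto simp: V_hat_ray_breakpoint)
    show ?thesis
      using \<omega>(1)[OF k] \<omega>'[OF k] by simp
  qed
  have "ray_path r (x r) \<omega>' x"
    unfolding ray_path_def
  proof (intro conjI allI ballI refl)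
    show "x \<in> extensional {r..}"
      using x by (simp add: topspace_Lambda_ray)
    show "x t = phi_from lamM lamE (?b k) (x (?b k)) (?b (Suc k)) \<omega>' t"
      if "t \<in> {?b k..?b (Suc k)}" for k t
      using phi_from_cong[of "?b k" "?b (Suc k)" \<omega>' "\<omega> k" "x (?b k)"] \<omega>' \<omega>(2)[of k] that
      by (simp add: y_def)
  qed
  then have "phi_ray_from lamM lamE r (x r) \<omega>' = x"
    using valid by (intro phi_ray_from_eqI[OF r])
  moreover have "\<omega>' \<in> topspace (cube (V_hat_ray r))"
    using valid by (auto simp: topspace_cube \<omega>'_def)
  ultimately show thesis
    using that by blast
qed

end


section \<open>Paths with a free starting point\<close>

lemma continuous_map_cube_coordinate:
  assumes "t \<in> T"
  shows "continuous_map (prod_topology Y (cube T)) (top_of_set {0..1}) (\<lambda>p. snd p t)"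
proof -
  have "continuous_map (cube T) (top_of_set {0..1}) (\<lambda>\<omega>. \<omega> t)"
    unfolding cube_def using assms by (rule continuous_map_product_projection)
  from continuous_map_compose[OF continuous_map_snd this] show ?thesis
    by (simp add: o_def)
qed

theorem theorem2p10:
  fixes c :: real
    and lamM :: "real \<Rightarrow> real \<Rightarrow> real \<Rightarrow> real \<Rightarrow> real \<Rightarrow> real"
    and lamE :: "real \<Rightarrow> real \<Rightarrow> real \<Rightarrow> real \<Rightarrow> real"
    and lamS :: "real \<Rightarrow> real \<Rightarrow> real"
    and r s :: real
  assumes "c > 0"
    and "\<And>r a s b. 0 \<le> r \<Longrightarrow> r < s \<Longrightarrow> parallelogram c r a s b \<noteq> {} \<Longrightarrow>
           continuous_on {0..1} (lamM r a s b) \<and>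
           lamM r a s b ` {0..1} = mid_interval c r a s b"
    and "continuous_on
           {(a, b, r, s, \<xi>). 0 \<le> r \<and> r < s \<and> \<bar>b - a\<bar> \<le> c * (s - r) \<and> \<xi> \<in> {0..1}}
           (\<lambda>(a, b, r, s, \<xi>). lamM r a s b \<xi>)"
    and "\<And>r a s. 0 \<le> r \<Longrightarrow> r < s \<Longrightarrow>
           continuous_on {0..1} (lamE r a s) \<and>
           lamE r a s ` {0..1} = end_interval c r a s"
    and "continuous_on
           {(a, r, s, \<xi>). 0 \<le> r \<and> r < s \<and> \<xi> \<in> {0..1}}
           (\<lambda>(a, r, s, \<xi>). lamE r a s \<xi>)"
    and "\<And>r. 0 \<le> r \<Longrightarrow> continuous_on UNIV (lamS r) \<and> surj (lamS r)"
    and "0 \<le> r" and "r < s"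
  shows "continuous_map (Omega_tilde r s) (Lambda c r s) (phi lamM lamE lamS r s) \<and>
         phi lamM lamE lamS r s ` topspace (Omega_tilde r s) = topspace (Lambda c r s) \<and>
         continuous_map (Omega_tilde_ray r) (Lambda_ray c r) (phi_ray lamM lamE lamS r) \<and>
         phi_ray lamM lamE lamS r ` topspace (Omega_tilde_ray r) = topspace (Lambda_ray c r)"
proof -
  interpret path_selection c lamM lamE
    using assms(1-5) by unfold_locales blast+
  have A: "continuous_map (prod_topology euclideanreal (cube T)) euclideanreal (\<lambda>p. lamS r (fst p))"
    for T
  proof -
    have "continuous_map euclideanreal euclideanreal (lamS r)"
      using assms(6)[OF \<open>0 \<le> r\<close>] by simp
    from continuous_map_compose[OF continuous_map_fst this] show ?thesis
      by (simp add: o_def)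
  qed
  have phi: "phi lamM lamE lamS r s = (\<lambda>p. phi_from lamM lamE r (lamS r (fst p)) s (snd p))"
    and phi_ray: "phi_ray lamM lamE lamS r = (\<lambda>p. phi_ray_from lamM lamE r (lamS r (fst p)) (snd p))"
    by (simp_all add: phi_def phi_ray_def case_prod_beta')
  have cont: "continuous_map (Omega_tilde r s) (Lambda c r s) (phi lamM lamE lamS r s)"
    unfolding phi Omega_tilde_def
    using assms(7,8) A continuous_map_cube_coordinate by (rule continuous_map_phi_from)
  have cont_ray: "continuous_map (Omega_tilde_ray r) (Lambda_ray c r) (phi_ray lamM lamE lamS r)"
    unfolding phi_ray Omega_tilde_ray_def
    using assms(7) A continuous_map_cube_coordinate by (rule continuous_map_phi_ray_from)
  have start: "\<exists>a. lamS r a = x" for x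
    using assms(6)[OF \<open>0 \<le> r\<close>] by (metis surjD)
  have "x \<in> phi lamM lamE lamS r s ` topspace (Omega_tilde r s)"
    if x: "x \<in> topspace (Lambda c r s)" for x
  proof -
    obtain a where a: "lamS r a = x r"
      using start by blast
    obtain \<omega> where \<omega>: "\<omega> \<in> topspace (cube (V_hat r s))" "phi_from lamM lamE r (x r) s \<omega> = x"
      using phi_from_onto[OF assms(7,8) x] by blast
    then have "x = phi lamM lamE lamS r s (a, \<omega>)"
      by (simp add: phi a)
    moreover have "(a, \<omega>) \<in> topspace (Omega_tilde r s)"
      using \<omega>(1) by (simp add: Omega_tilde_def)
    ultimately show ?thesis
      by (rule image_eqI)
  qed
  moreover have "x \<in> phi_ray lamM lamE lamS r ` topspace (Omega_tilde_ray r)"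
    if x: "x \<in> topspace (Lambda_ray c r)" for x
  proof -
    obtain a where a: "lamS r a = x r"
      using start by blast
    obtain \<omega> where \<omega>: "\<omega> \<in> topspace (cube (V_hat_ray r))" "phi_ray_from lamM lamE r (x r) \<omega> = x"
      using phi_ray_from_onto[OF assms(7) x] by blast
    then have "x = phi_ray lamM lamE lamS r (a, \<omega>)"
      by (simp add: phi_ray a)
    moreover have "(a, \<omega>) \<in> topspace (Omega_tilde_ray r)"
      using \<omega>(1) by (simp add: Omega_tilde_ray_def)
    ultimately show ?thesis
      by (rule image_eqI)
  qed
  ultimately show ?thesis
    using cont cont_ray continuous_map_image_subset_topspace by blast
qed

end
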